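(* Let $\mathcal H$ be a Hilbert space and let $p_1,\ldots,p_n$ be polynomials. Define $$G_{p_1,\ldots,p_n}=\{a\in Q(\mathcal H): r(p_i(a))<\|p_i(a)\|,\ i=1,\ldots,n\}$$ and $\Sigma_{p_1,\ldots,p_n}=q^{-1}(G_{p_1,\ldots,p_n})\subseteq\mathcal B(\mathcal H)$. Then the complement of $\Sigma_{p_1,\ldots,p_n}$ in $\mathcal B(\mathcal H)$ is nowhere dense.
   Context: $\mathcal B(\mathcal H)$ is the space of all bounded operators on $\mathcal H$ (with the operator norm topology), $\mathcal K(\mathcal H)$ the ideal of all compact operators, $Q(\mathcal H)=\mathcal B(\mathcal H)/\mathcal K(\mathcal H)$ the Calkin algebra, and $q:\mathcal B(\mathcal H)\to Q(\mathcal H)$ the canonical surjection. The spectral radius $r(p_i(a))$ and the norm $\|p_i(a)\|$ are taken in $Q(\mathcal H)$.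
   Formalization: The Hilbert space is assumed infinite-dimensional and each polynomial nonconstant; if the space is finite-dimensional (zero Calkin algebra) or some polynomial is constant, then G is empty and its complement is everything, so the claim fails. *)

theory Defs
  imports
    "HOL-Analysis.Analysis"
    "HOL-Computational_Algebra.Polynomial"
begin

subsection \<open>Complex vector spaces, complex algebras, complex Hilbert spaces\<close>

class scaleC =
  fixes scaleC :: "complex \<Rightarrow> 'a \<Rightarrow> 'a"  (infixr \<open>*\<^sub>C\<close> 75)

class complex_vector = ab_group_add + scaleC +
  assumes scaleC_add_right: "a *\<^sub>C (x + y) = a *\<^sub>C x + a *\<^sub>C y"
    and scaleC_add_left: "(a + b) *\<^sub>C x = a *\<^sub>C x + b *\<^sub>C x"
    and scaleC_scaleC: "a *\<^sub>C (b *\<^sub>C x) = (a * b) *\<^sub>C x"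
    and scaleC_one: "1 *\<^sub>C x = x"

lemma vector_space_scaleC: "vector_space ((*\<^sub>C) :: complex \<Rightarrow> 'a \<Rightarrow> 'a::complex_vector)"
  by standard (fact scaleC_add_right scaleC_add_left scaleC_scaleC scaleC_one)+

text \<open>Unital complex algebras; the degenerate case \<open>1 = 0\<close> is not excluded, because both
  operator algebras below degenerate for small Hilbert spaces.\<close>

class complex_algebra = complex_vector + ring + monoid_mult +
  assumes mult_scaleC_left: "(a *\<^sub>C x) * y = a *\<^sub>C (x * y)"
    and mult_scaleC_right: "x * (a *\<^sub>C y) = a *\<^sub>C (x * y)"

text \<open>The inner product is linear in the first argument. Completeness comes from
  class \<open>banach\<close>; the last axiom says that the norm is the one induced by the inner product, and
  yields positive definiteness.\<close>

class complex_hilbert_space = banach + complex_vector +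
  fixes cinner :: "'a \<Rightarrow> 'a \<Rightarrow> complex"
  assumes scaleR_scaleC: "r *\<^sub>R x = complex_of_real r *\<^sub>C x"
    and cinner_commute: "cinner x y = cnj (cinner y x)"
    and cinner_add_left: "cinner (x + y) z = cinner x z + cinner y z"
    and cinner_scaleC_left: "cinner (a *\<^sub>C x) y = a * cinner x y"
    and cinner_self: "cinner x x = complex_of_real ((norm x)\<^sup>2)"

definition finite_dimensional :: "'a::complex_vector itself \<Rightarrow> bool"
  where "finite_dimensional _ \<longleftrightarrow>
    (\<exists>B::'a set. finite B \<and> module.span (*\<^sub>C) B = (UNIV :: 'a set))"

definition poly_eval :: "complex poly \<Rightarrow> 'a::complex_algebra \<Rightarrow> 'a"
  where "poly_eval p a = (\<Sum>i\<le>degree p. coeff p i *\<^sub>C a ^ i)"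

definition spectrum :: "'a::complex_algebra \<Rightarrow> complex set"
  where "spectrum a =
    {l. \<not> (\<exists>b. b * (a - l *\<^sub>C 1) = 1 \<and> (a - l *\<^sub>C 1) * b = 1)}"

text \<open>Meaningful when the spectrum is nonempty and bounded, as it is in a nonzero Banach algebra.\<close>

definition spectral_radius :: "'a::complex_algebra \<Rightarrow> real"
  where "spectral_radius a = Sup (cmod ` spectrum a)"

definition nowhere_dense :: "'a::topological_space set \<Rightarrow> bool"
  where "nowhere_dense S \<longleftrightarrow> interior (closure S) = {}"

lemma norm_scaleC: "norm (a *\<^sub>C x) = cmod a * norm (x :: 'a::complex_hilbert_space)"
proof -
  have "complex_of_real ((norm (a *\<^sub>C x))\<^sup>2) = a * cinner x (a *\<^sub>C x)"
    by (simp only: cinner_self[symmetric] cinner_scaleC_left)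
  also have "cinner x (a *\<^sub>C x) = cnj (a * cinner x x)"
    by (metis cinner_commute cinner_scaleC_left)
  also have "a * \<dots> = complex_of_real ((cmod a * norm x)\<^sup>2)"
    using complex_norm_square[of a] by (simp add: cinner_self power_mult_distrib)
  finally have "(norm (a *\<^sub>C x))\<^sup>2 = (cmod a * norm x)\<^sup>2"
    by (simp only: of_real_eq_iff)
  then show ?thesis
    by (simp add: power2_eq_iff_nonneg)
qed

lemma bounded_linear_scaleC: "bounded_linear (\<lambda>x :: 'a::complex_hilbert_space. a *\<^sub>C x)"
  by (rule bounded_linear_intro[where K = "cmod a"])
    (simp_all add: scaleC_add_right scaleR_scaleC scaleC_scaleC norm_scaleC mult.commute)


subsection \<open>Bounded operators on a complex Hilbert space\<close>

typedef (overloaded) 'a bop =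
  "{T :: 'a::complex_hilbert_space \<Rightarrow>\<^sub>L 'a. \<forall>c x. blinfun_apply T (c *\<^sub>C x) = c *\<^sub>C blinfun_apply T x}"
  morphisms blinfun_of_bop Bop
  by (rule exI[of _ id_blinfun]) simp

setup_lifting type_definition_bop

lift_definition bop_apply :: "'a::complex_hilbert_space bop \<Rightarrow> 'a \<Rightarrow> 'a" is blinfun_apply .

lemma scaleC_zero_right: "a *\<^sub>C (0 :: 'a::complex_vector) = 0"
  using scaleC_add_right[of a "0 :: 'a" 0] by simp

lemma scaleC_minus_right: "a *\<^sub>C (- x :: 'a::complex_vector) = - (a *\<^sub>C x)"
  using scaleC_add_right[of a "- x" x] by (simp add: scaleC_zero_right eq_neg_iff_add_eq_0)

lemma scaleC_diff_right: "a *\<^sub>C (x - y :: 'a::complex_vector) = a *\<^sub>C x - a *\<^sub>C y"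
  using scaleC_add_right[of a x "- y"] by (simp add: scaleC_minus_right)

instantiation bop :: (complex_hilbert_space) real_normed_vector
begin

lift_definition zero_bop :: "'a bop" is 0
  by (simp add: scaleC_zero_right)
lift_definition plus_bop :: "'a bop \<Rightarrow> 'a bop \<Rightarrow> 'a bop" is "(+)"
  by (simp add: blinfun.add_left scaleC_add_right)
lift_definition minus_bop :: "'a bop \<Rightarrow> 'a bop \<Rightarrow> 'a bop" is "(-)"
  by (simp add: blinfun.diff_left scaleC_diff_right)
lift_definition uminus_bop :: "'a bop \<Rightarrow> 'a bop" is uminus
  by (simp add: blinfun.minus_left scaleC_minus_right)
lift_definition scaleR_bop :: "real \<Rightarrow> 'a bop \<Rightarrow> 'a bop" is scaleR
  by (simp add: blinfun.scaleR_left scaleR_scaleC scaleC_scaleC mult.commute)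
lift_definition norm_bop :: "'a bop \<Rightarrow> real" is norm .

definition dist_bop :: "'a bop \<Rightarrow> 'a bop \<Rightarrow> real"
  where "dist_bop S T = norm (S - T)"
definition sgn_bop :: "'a bop \<Rightarrow> 'a bop"
  where "sgn_bop T = scaleR (inverse (norm T)) T"
definition [code del]:
  "(uniformity :: ('a bop \<times> 'a bop) filter) = (INF e\<in>{0<..}. principal {(x, y). dist x y < e})"
definition open_bop :: "'a bop set \<Rightarrow> bool"
  where "open_bop U = (\<forall>x\<in>U. \<forall>\<^sub>F (x', y) in uniformity. x' = x \<longrightarrow> y \<in> U)"

instance
proof
  fix S T U :: "'a bop" and r s :: real
  show "S + T + U = S + (T + U)" by transfer (rule add.assoc)
  show "S + T = T + S" by transfer (rule add.commute)
  show "0 + T = T" by transfer simp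
  show "- T + T = 0" by transfer simp
  show "S - T = S + - T" by transfer simp
  show "r *\<^sub>R (S + T) = r *\<^sub>R S + r *\<^sub>R T" by transfer (rule scaleR_add_right)
  show "(r + s) *\<^sub>R T = r *\<^sub>R T + s *\<^sub>R T" by transfer (rule scaleR_add_left)
  show "r *\<^sub>R s *\<^sub>R T = (r * s) *\<^sub>R T" by transfer simp
  show "1 *\<^sub>R T = T" by transfer simp
  show "(norm T = 0) = (T = 0)" by transfer simp
  show "norm (S + T) \<le> norm S + norm T" by transfer (rule norm_triangle_ineq)
  show "norm (r *\<^sub>R T) = \<bar>r\<bar> * norm T" by transfer simp
qed (simp_all add: dist_bop_def sgn_bop_def uniformity_bop_def open_bop_def)

end

lift_definition scaleC_blinfun ::
  "complex \<Rightarrow> ('b::real_normed_vector \<Rightarrow>\<^sub>L 'a::complex_hilbert_space) \<Rightarrow> 'b \<Rightarrow>\<^sub>L 'a"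
  is "\<lambda>c f x. c *\<^sub>C f x"
  by (rule bounded_linear_compose[OF bounded_linear_scaleC])

instantiation bop :: (complex_hilbert_space) complex_algebra
begin

lift_definition scaleC_bop :: "complex \<Rightarrow> 'a bop \<Rightarrow> 'a bop"
  is scaleC_blinfun
  by (simp add: scaleC_blinfun.rep_eq scaleC_scaleC mult.commute)
lift_definition one_bop :: "'a bop" is id_blinfun
  by simp
lift_definition times_bop :: "'a bop \<Rightarrow> 'a bop \<Rightarrow> 'a bop" is "(o\<^sub>L)"
  by simp

instance
proof
  fix S T U :: "'a bop" and a b :: complex
  show "a *\<^sub>C (S + T) = a *\<^sub>C S + a *\<^sub>C T"
    by transfer (auto intro!: blinfun_eqI simp: scaleC_blinfun.rep_eq blinfun.add_left scaleC_add_right)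
  show "(a + b) *\<^sub>C T = a *\<^sub>C T + b *\<^sub>C T"
    by transfer (auto intro!: blinfun_eqI simp: scaleC_blinfun.rep_eq blinfun.add_left scaleC_add_left)
  show "a *\<^sub>C b *\<^sub>C T = (a * b) *\<^sub>C T"
    by transfer (auto intro!: blinfun_eqI simp: scaleC_blinfun.rep_eq scaleC_scaleC)
  show "1 *\<^sub>C T = T"
    by transfer (auto intro!: blinfun_eqI simp: scaleC_blinfun.rep_eq scaleC_one)
  show "S * T * U = S * (T * U)"
    by transfer (auto intro!: blinfun_eqI)
  show "(S + T) * U = S * U + T * U"
    by transfer (auto intro!: blinfun_eqI simp: blinfun.add_left)
  show "S * (T + U) = S * T + S * U"
    by transfer (auto intro!: blinfun_eqI simp: blinfun.add_left blinfun.add_right)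
  show "1 * T = T"
    by transfer (auto intro!: blinfun_eqI)
  show "T * 1 = T"
    by transfer (auto intro!: blinfun_eqI)
  show "(a *\<^sub>C S) * T = a *\<^sub>C (S * T)"
    by transfer (auto intro!: blinfun_eqI simp: scaleC_blinfun.rep_eq)
  show "S * (a *\<^sub>C T) = a *\<^sub>C (S * T)"
    by transfer (auto intro!: blinfun_eqI simp: scaleC_blinfun.rep_eq)
qed

end

lemma scaleR_bop_scaleC: "r *\<^sub>R T = complex_of_real r *\<^sub>C (T :: 'a::complex_hilbert_space bop)"
  by transfer (auto intro!: blinfun_eqI simp: scaleC_blinfun.rep_eq blinfun.scaleR_left scaleR_scaleC)

instance bop :: (complex_hilbert_space) real_normed_algebra
proof
  fix S T :: "'a bop" and r :: real
  show "r *\<^sub>R S * T = r *\<^sub>R (S * T)" by (simp add: scaleR_bop_scaleC mult_scaleC_left)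
  show "S * r *\<^sub>R T = r *\<^sub>R (S * T)" by (simp add: scaleR_bop_scaleC mult_scaleC_right)
  show "norm (S * T) \<le> norm S * norm T" by transfer (rule norm_blinfun_compose)
qed

lemma bop_apply_simps:
  "bop_apply 0 x = 0"
  "bop_apply 1 x = x"
  "bop_apply (S + T) x = bop_apply S x + bop_apply T x"
  "bop_apply (S - T) x = bop_apply S x - bop_apply T x"
  "bop_apply (- T) x = - bop_apply T x"
  "bop_apply (S * T) x = bop_apply S (bop_apply T x)"
  "bop_apply (c *\<^sub>C T) x = c *\<^sub>C bop_apply T x"
  by (transfer; simp add: blinfun.bilinear_simps scaleC_blinfun.rep_eq)+

lemma bounded_linear_bop_apply: "bounded_linear (bop_apply T)"
  by transfer (rule blinfun.bounded_linear_right)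


subsection \<open>Compact operators\<close>

definition compact_op :: "'a::complex_hilbert_space bop \<Rightarrow> bool"
  where "compact_op T \<longleftrightarrow> compact (closure (bop_apply T ` cball 0 1))"

lemma compact_opI:
  assumes "compact C" and "\<And>x. norm x \<le> 1 \<Longrightarrow> bop_apply T x \<in> C"
  shows "compact_op T"
proof -
  have "closure (bop_apply T ` cball 0 1) \<subseteq> C"
    using assms by (intro closure_minimal) (auto simp: compact_imp_closed)
  then show ?thesis
    unfolding compact_op_def using assms(1) by (metis closed_closure compact_Int_closed inf.absorb2)
qed

lemma compact_opE:
  assumes "compact_op T"
  obtains C where "compact C" "\<And>x. norm x \<le> 1 \<Longrightarrow> bop_apply T x \<in> C"
proof
  show "compact (closure (bop_apply T ` cball 0 1))"
    using assms by (simp add: compact_op_def)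
  show "bop_apply T x \<in> closure (bop_apply T ` cball 0 1)" if "norm x \<le> 1" for x
    using that closure_subset by fastforce
qed

lemma compact_op_0: "compact_op 0"
  by (rule compact_opI[of "{0}"]) (auto simp: bop_apply_simps)

lemma compact_op_mult_left: "compact_op T \<Longrightarrow> compact_op (S * T)"
proof (erule compact_opE)
  fix C assume C: "compact C" "\<And>x. norm x \<le> 1 \<Longrightarrow> bop_apply T x \<in> C"
  show "compact_op (S * T)"
    using C
    by (intro compact_opI[of "bop_apply S ` C"] compact_continuous_image
        linear_continuous_on bounded_linear_bop_apply) (auto simp: bop_apply_simps)
qed

lemma compact_op_scaleC: "compact_op T \<Longrightarrow> compact_op (c *\<^sub>C T)"
  using compact_op_mult_left[of T "c *\<^sub>C 1"] by (simp add: mult_scaleC_left)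

lemma compact_op_uminus: "compact_op T \<Longrightarrow> compact_op (- T)"
  using compact_op_mult_left[of T "- 1"] by simp

lemma compact_op_add: "compact_op S \<Longrightarrow> compact_op T \<Longrightarrow> compact_op (S + T)"
proof (elim compact_opE)
  fix C D
  assume "compact C" "\<And>x. norm x \<le> 1 \<Longrightarrow> bop_apply S x \<in> C"
    "compact D" "\<And>x. norm x \<le> 1 \<Longrightarrow> bop_apply T x \<in> D"
  then show "compact_op (S + T)"
    by (intro compact_opI[OF compact_sums[of C D]]) (auto simp: bop_apply_simps)
qed

lemma compact_op_mult_right:
  assumes "compact_op T"
  shows "compact_op (T * S)"
proof -
  obtain C where C: "compact C" "\<And>x. norm x \<le> 1 \<Longrightarrow> bop_apply T x \<in> C"
    using assms by (rule compact_opE) blast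
  obtain B where B: "B > 0" "\<And>x. norm (bop_apply S x) \<le> norm x * B"
    using bounded_linear.pos_bounded[OF bounded_linear_bop_apply[of S]] by blast
  interpret T: bounded_linear "bop_apply T" by (rule bounded_linear_bop_apply)
  show ?thesis
  proof (rule compact_opI[OF compact_scaling[OF C(1), of B]])
    fix x :: 'a assume "norm x \<le> 1"
    then have "norm (bop_apply S x) \<le> B"
      using B(2)[of x] B(1) by (smt (verit) mult_left_le_one_le norm_ge_zero)
    then have "bop_apply T ((1 / B) *\<^sub>R bop_apply S x) \<in> C"
      using B(1) by (intro C(2)) simp
    moreover have "bop_apply (T * S) x = B *\<^sub>R bop_apply T ((1 / B) *\<^sub>R bop_apply S x)"
      using B(1) by (simp add: bop_apply_simps T.scaleR)
    ultimately show "bop_apply (T * S) x \<in> (*\<^sub>R) B ` C" by blast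
  qed
qed


subsection \<open>The Calkin algebra\<close>

definition calkin_rel :: "'a::complex_hilbert_space bop \<Rightarrow> 'a bop \<Rightarrow> bool"
  where "calkin_rel S T \<longleftrightarrow> compact_op (S - T)"

quotient_type (overloaded) 'a calkin = "'a::complex_hilbert_space bop" / calkin_rel
  morphisms rep_calkin calkin_proj
proof (rule equivpI)
  show "reflp (calkin_rel :: 'a bop \<Rightarrow> _)"
    by (simp add: reflp_def calkin_rel_def compact_op_0)
  show "symp (calkin_rel :: 'a bop \<Rightarrow> _)"
    unfolding symp_def calkin_rel_def by (metis compact_op_uminus minus_diff_eq)
  show "transp (calkin_rel :: 'a bop \<Rightarrow> _)"
    unfolding transp_def calkin_rel_def by (metis compact_op_add diff_add_cancel add_diff_eq)
qed

instantiation calkin :: (complex_hilbert_space) complex_algebra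
begin

lift_definition zero_calkin :: "'a calkin" is 0 .
lift_definition one_calkin :: "'a calkin" is 1 .
lift_definition plus_calkin :: "'a calkin \<Rightarrow> 'a calkin \<Rightarrow> 'a calkin" is "(+)"
  unfolding calkin_rel_def by (metis compact_op_add add_diff_add)
lift_definition uminus_calkin :: "'a calkin \<Rightarrow> 'a calkin" is uminus
  unfolding calkin_rel_def by (metis compact_op_uminus minus_diff_minus)
lift_definition minus_calkin :: "'a calkin \<Rightarrow> 'a calkin \<Rightarrow> 'a calkin" is "(-)"
  unfolding calkin_rel_def
proof -
  fix S S' T T' :: "'a bop"
  assume "compact_op (S - S')" "compact_op (T - T')"
  then have "compact_op ((S - S') + - (T - T'))"
    by (intro compact_op_add compact_op_uminus)
  then show "compact_op (S - T - (S' - T'))" by (simp add: algebra_simps)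
qed
lift_definition times_calkin :: "'a calkin \<Rightarrow> 'a calkin \<Rightarrow> 'a calkin" is "(*)"
  unfolding calkin_rel_def
proof -
  fix S S' T T' :: "'a bop"
  assume "compact_op (S - S')" "compact_op (T - T')"
  then have "compact_op ((S - S') * T + S' * (T - T'))"
    by (intro compact_op_add compact_op_mult_left compact_op_mult_right)
  then show "compact_op (S * T - S' * T')" by (simp add: algebra_simps)
qed
lift_definition scaleC_calkin :: "complex \<Rightarrow> 'a calkin \<Rightarrow> 'a calkin" is "(*\<^sub>C)"
  unfolding calkin_rel_def by (metis compact_op_scaleC scaleC_diff_right)

instance
proof
  have eq: "S = T \<Longrightarrow> calkin_rel S T" for S T :: "'a bop"
    by (simp add: calkin_rel_def compact_op_0)
  fix x y z :: "'a calkin" and a b :: complex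
  show "x + y + z = x + (y + z)" by transfer (rule eq, simp add: algebra_simps)
  show "x + y = y + x" by transfer (rule eq, simp add: algebra_simps)
  show "0 + x = x" by transfer (rule eq, simp)
  show "- x + x = 0" by transfer (rule eq, simp)
  show "x - y = x + - y" by transfer (rule eq, simp)
  show "a *\<^sub>C (x + y) = a *\<^sub>C x + a *\<^sub>C y" by transfer (rule eq, rule scaleC_add_right)
  show "(a + b) *\<^sub>C x = a *\<^sub>C x + b *\<^sub>C x" by transfer (rule eq, rule scaleC_add_left)
  show "a *\<^sub>C b *\<^sub>C x = (a * b) *\<^sub>C x" by transfer (rule eq, rule scaleC_scaleC)
  show "1 *\<^sub>C x = x" by transfer (rule eq, rule scaleC_one)
  show "x * y * z = x * (y * z)" by transfer (rule eq, rule mult.assoc)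
  show "(x + y) * z = x * z + y * z" by transfer (rule eq, rule distrib_right)
  show "x * (y + z) = x * y + x * z" by transfer (rule eq, rule distrib_left)
  show "1 * x = x" by transfer (rule eq, simp)
  show "x * 1 = x" by transfer (rule eq, simp)
  show "(a *\<^sub>C x) * y = a *\<^sub>C (x * y)" by transfer (rule eq, rule mult_scaleC_left)
  show "x * (a *\<^sub>C y) = a *\<^sub>C (x * y)" by transfer (rule eq, rule mult_scaleC_right)
qed

end

lemma compact_op_limit:
  fixes T :: "'a::complex_hilbert_space bop"
  assumes "\<And>e. e > 0 \<Longrightarrow> \<exists>K. compact_op K \<and> norm (T - K) < e"
  shows "compact_op T"
  unfolding compact_op_def compact_eq_totally_bounded
proof (intro conjI allI impI)
  show "complete (closure (bop_apply T ` cball 0 1))"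
    by (simp add: complete_eq_closed)
  fix e :: real assume e: "e > 0"
  then obtain K where K: "compact_op K" "norm (T - K) < e / 3"
    using assms[of "e / 3"] by auto
  obtain C where C: "compact C" "\<And>x. norm x \<le> 1 \<Longrightarrow> bop_apply K x \<in> C"
    using K(1) by (rule compact_opE) blast
  obtain k where k: "finite k" "C \<subseteq> (\<Union>x\<in>k. ball x (e / 3))"
    using C(1) e unfolding compact_eq_totally_bounded by (meson divide_pos_pos zero_less_numeral)
  have "bop_apply T ` cball 0 1 \<subseteq> (\<Union>x\<in>k. cball x (2 * e / 3))"
  proof clarify
    fix x :: 'a assume "x \<in> cball 0 1"
    then have x: "norm x \<le> 1" by simp
    obtain y where y: "y \<in> k" "dist y (bop_apply K x) < e / 3"
      using C(2)[OF x] k(2) by auto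
    have "dist (bop_apply T x) (bop_apply K x) = norm (bop_apply (T - K) x)"
      by (simp add: bop_apply_simps dist_norm)
    also have "\<dots> \<le> norm (T - K) * norm x"
      by transfer (rule norm_blinfun)
    also have "\<dots> \<le> norm (T - K)"
      using x by (simp add: mult_left_le)
    finally have "dist y (bop_apply T x) \<le> 2 * e / 3"
      using y(2) K(2) dist_triangle2[of y "bop_apply T x" "bop_apply K x"] by linarith
    then show "bop_apply T x \<in> (\<Union>x\<in>k. cball x (2 * e / 3))"
      using y(1) by auto
  qed
  then have "closure (bop_apply T ` cball 0 1) \<subseteq> (\<Union>x\<in>k. cball x (2 * e / 3))"
    using k(1) by (intro closure_minimal closed_UN) auto
  also have "\<dots> \<subseteq> (\<Union>x\<in>k. ball x e)"
    using e by fastforce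
  finally show "\<exists>k. finite k \<and> closure (bop_apply T ` cball 0 1) \<subseteq> (\<Union>x\<in>k. ball x e)"
    using k(1) by blast
qed

lemma calkin_proj_surj: "\<exists>T. calkin_proj T = a"
  by (metis Quotient_calkin Quotient_abs_rep)

lemma calkin_proj_eq_iff: "calkin_proj S = calkin_proj T \<longleftrightarrow> compact_op (S - T)"
  by (simp add: calkin.abs_eq_iff calkin_rel_def)

text \<open>The norm on the Calkin algebra is the quotient norm.\<close>

instantiation calkin :: (complex_hilbert_space) real_normed_algebra
begin

definition scaleR_calkin :: "real \<Rightarrow> 'a calkin \<Rightarrow> 'a calkin"
  where "scaleR_calkin r a = complex_of_real r *\<^sub>C a"

definition norm_calkin :: "'a calkin \<Rightarrow> real"
  where "norm_calkin a = Inf {norm T | T. calkin_proj T = a}"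

definition dist_calkin :: "'a calkin \<Rightarrow> 'a calkin \<Rightarrow> real"
  where "dist_calkin a b = norm (a - b)"
definition sgn_calkin :: "'a calkin \<Rightarrow> 'a calkin"
  where "sgn_calkin a = scaleR (inverse (norm a)) a"
definition [code del]:
  "(uniformity :: ('a calkin \<times> 'a calkin) filter) = (INF e\<in>{0<..}. principal {(x, y). dist x y < e})"
definition open_calkin :: "'a calkin set \<Rightarrow> bool"
  where "open_calkin U = (\<forall>x\<in>U. \<forall>\<^sub>F (x', y) in uniformity. x' = x \<longrightarrow> y \<in> U)"

lemma norm_calkin_proj_le: "norm (calkin_proj T :: 'a calkin) \<le> norm T"
  unfolding norm_calkin_def by (rule cInf_lower) (auto intro!: bdd_belowI[of _ 0])

lemma norm_calkin_greatest:
  "(\<And>T. calkin_proj T = a \<Longrightarrow> c \<le> norm T) \<Longrightarrow> c \<le> norm (a :: 'a calkin)"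
  unfolding norm_calkin_def using calkin_proj_surj[of a] by (intro cInf_greatest) auto

lemma norm_calkin_approx:
  assumes "e > 0"
  obtains T where "calkin_proj T = a" "norm T < norm (a :: 'a calkin) + e"
proof -
  have "\<not> (\<forall>T. calkin_proj T = a \<longrightarrow> norm a + e \<le> norm T)"
    using norm_calkin_greatest[of a "norm a + e"] assms by auto
  then show ?thesis using that by force
qed

instance
proof
  fix a b :: "'a calkin" and r s :: real
  have nonneg: "0 \<le> norm c" for c :: "'a calkin"
    by (rule norm_calkin_greatest) simp
  show "r *\<^sub>R (a + b) = r *\<^sub>R a + r *\<^sub>R b" by (simp add: scaleR_calkin_def scaleC_add_right)
  show "(r + s) *\<^sub>R a = r *\<^sub>R a + s *\<^sub>R a" by (simp add: scaleR_calkin_def scaleC_add_left)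
  show rsa: "r *\<^sub>R s *\<^sub>R a = (r * s) *\<^sub>R a" for r s and a :: "'a calkin"
    by (simp add: scaleR_calkin_def scaleC_scaleC)
  show one: "1 *\<^sub>R a = a" for a :: "'a calkin" by (simp add: scaleR_calkin_def scaleC_one)
  show "r *\<^sub>R a * b = r *\<^sub>R (a * b)" by (simp add: scaleR_calkin_def mult_scaleC_left)
  show "a * r *\<^sub>R b = r *\<^sub>R (a * b)" by (simp add: scaleR_calkin_def mult_scaleC_right)
  show "(norm a = 0) = (a = 0)"
  proof
    assume "a = 0"
    then show "norm a = 0"
      using norm_calkin_proj_le[of 0] nonneg[of 0] by (simp add: zero_calkin.abs_eq[symmetric])
  next
    assume a: "norm a = 0"
    obtain T where T: "calkin_proj T = a" using calkin_proj_surj by blast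
    have "compact_op T"
    proof (rule compact_op_limit)
      fix e :: real assume "e > 0"
      then obtain S where "calkin_proj S = a" "norm S < e"
        using norm_calkin_approx[of e a] a by auto
      then show "\<exists>K. compact_op K \<and> norm (T - K) < e"
        using T by (intro exI[of _ "T - S"]) (simp add: calkin_proj_eq_iff[symmetric])
    qed
    then show "a = 0"
      using T calkin_proj_eq_iff[of T 0] by (simp add: zero_calkin.abs_eq)
  qed
  have "norm (a + b) - norm a \<le> norm b"
  proof (rule norm_calkin_greatest)
    fix T assume T: "calkin_proj T = b"
    have "norm (a + b) - norm T \<le> norm a"
    proof (rule norm_calkin_greatest)
      fix S assume "calkin_proj S = a"
      then have "norm (a + b) \<le> norm (S + T)"
        using T norm_calkin_proj_le[of "S + T"] by (simp add: plus_calkin.abs_eq[symmetric])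
      then show "norm (a + b) - norm T \<le> norm S"
        using norm_triangle_ineq[of S T] by linarith
    qed
    then show "norm (a + b) - norm a \<le> norm T" by linarith
  qed
  then show "norm (a + b) \<le> norm a + norm b" by linarith
  have scale: "norm (r *\<^sub>R a) \<le> \<bar>r\<bar> * norm a" if "r \<noteq> 0" for r and a :: "'a calkin"
  proof -
    have "norm (r *\<^sub>R a) / \<bar>r\<bar> \<le> norm a"
    proof (rule norm_calkin_greatest)
      fix T assume "calkin_proj T = a"
      then have "calkin_proj (r *\<^sub>R T) = r *\<^sub>R a"
        by (auto simp: scaleR_calkin_def scaleR_bop_scaleC scaleC_calkin.abs_eq)
      then show "norm (r *\<^sub>R a) / \<bar>r\<bar> \<le> norm T"
        using norm_calkin_proj_le[of "r *\<^sub>R T"] that by (simp add: field_simps)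
    qed
    then show ?thesis using that by (simp add: field_simps)
  qed
  show "norm (r *\<^sub>R a) = \<bar>r\<bar> * norm a"
  proof (cases "r = 0")
    case True
    have "r *\<^sub>R a = calkin_proj 0"
      using True rsa[of 0 0 a] scaleC_add_left[of 0 0 a]
      by (simp add: scaleR_calkin_def zero_calkin.abs_eq)
    then show ?thesis
      using True norm_calkin_proj_le[of 0] nonneg[of "r *\<^sub>R a"] by simp
  next
    case False
    have "norm a \<le> \<bar>inverse r\<bar> * norm (r *\<^sub>R a)"
      using scale[of "inverse r" "r *\<^sub>R a"] False by (simp add: rsa one)
    then show ?thesis
      using scale[OF False, of a] False by (simp add: field_simps)
  qed
  have "norm (a * b) \<le> norm S * norm b" if S: "calkin_proj S = a" for S
  proof -
    have *: "norm (a * b) \<le> norm S * norm T" if "calkin_proj T = b" for T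
    proof -
      have "norm (a * b) \<le> norm (S * T)"
        using S that norm_calkin_proj_le[of "S * T"] by (simp add: times_calkin.abs_eq[symmetric])
      then show ?thesis using norm_mult_ineq[of S T] by linarith
    qed
    show ?thesis
    proof (cases "norm S = 0")
      case True
      then show ?thesis using * calkin_proj_surj[of b] by auto
    next
      case False
      then have pos: "norm S > 0" using norm_ge_zero[of S] by linarith
      have "norm (a * b) / norm S \<le> norm b"
        using * pos by (intro norm_calkin_greatest) (simp add: field_simps)
      then show ?thesis using pos by (simp add: field_simps)
    qed
  qed
  note * = this
  show "norm (a * b) \<le> norm a * norm b"
  proof (cases "norm b = 0")
    case True
    then show ?thesis using * calkin_proj_surj[of a] by auto
  next
    case False
    then have pos: "norm b > 0" using nonneg[of b] by linarith
    have "norm (a * b) / norm b \<le> norm a"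
      using * pos by (intro norm_calkin_greatest) (simp add: field_simps)
    then show ?thesis using pos by (simp add: field_simps)
  qed
qed (simp_all add: dist_calkin_def sgn_calkin_def uniformity_calkin_def open_calkin_def)

end


subsection \<open>The sets in question\<close>

text \<open>The polynomials are \<open>p 1, \<dots>, p n\<close>; spectral radius and norm are those of the Calkin algebra.\<close>

definition calkin_G :: "nat \<Rightarrow> (nat \<Rightarrow> complex poly) \<Rightarrow> 'a::complex_hilbert_space calkin set"
  where "calkin_G n p =
    {a. \<forall>i\<in>{1..n}. spectral_radius (poly_eval (p i) a) < norm (poly_eval (p i) a)}"

definition calkin_Sigma :: "nat \<Rightarrow> (nat \<Rightarrow> complex poly) \<Rightarrow> 'a::complex_hilbert_space bop set"
  where "calkin_Sigma n p = calkin_proj -` calkin_G n p"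

end

theory Submission
  imports Defs
    "HOL-Complex_Analysis.Conformal_Mappings"
    "HOL-Computational_Algebra.Fundamental_Theorem_Algebra"
begin

text \<open>
  A finite intersection of open dense sets is open and dense, so the claim reduces to one
  nonconstant polynomial \<open>p\<close>: the operators \<open>T\<close> with \<open>r(p(a)) < \<parallel>p(a)\<parallel>\<close>, where \<open>a = q(T)\<close> and \<open>q\<close>
  is the quotient map onto the Calkin algebra, form an open dense set.

  Openness is upper semicontinuity of the spectrum (\<open>open_spectral_radius_less_norm\<close>). It uses only
  that elements close to \<open>1\<close> are invertible and that the spectrum is compact and nonempty.

  For density, choose \<open>l\<close> in the spectrum of \<open>a\<close> at which \<open>\<bar>p\<bar>\<close> is maximal. By the maximum modulus
  principle \<open>l\<close> is a boundary point of the spectrum, so \<open>a - l\<close> is a topological divisor of zero.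
  In the Calkin algebra such divisors come from approximate eigenvectors that avoid any prescribed
  finite-dimensional subspace, so there is an orthonormal sequence \<open>e\<close> along which
  \<open>\<parallel>(T - l) e\<^sub>n\<parallel> \<le> 2\<^sup>-\<^sup>n\<close> (\<open>approximate_eigenvectors\<close>). Cut the sequence into blocks of length
  \<open>m + 1\<close>, where \<open>m\<close> is the degree of \<open>p\<close>, and let \<open>N\<close> be the backward shift inside each block, so
  that \<open>N\<close> is nilpotent and \<open>(T - l) N\<close> is compact. Put \<open>S = T + c N\<close> with a small scalar \<open>c \<noteq> 0\<close>.

  The perturbation does not enlarge the spectrum: since \<open>a q(N) = l q(N)\<close>,
  \<open>q(S) - \<mu> = (a - \<mu>) (1 + c (l - \<mu>)\<^sup>-\<^sup>1 q(N))\<close> for every \<open>\<mu>\<close> outside the spectrum of \<open>a\<close>,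
  and the second factor is invertible because \<open>q(N)\<close> is nilpotent
  (\<open>spectrum_nilpotent_perturbation\<close>). Hence \<open>r(p(q(S))) \<le> \<bar>p(l)\<bar>\<close>. On the other hand \<open>S\<close> acts on
  each block, up to an error that vanishes along the sequence, as a Jordan block with eigenvalue
  \<open>l\<close>. Applying \<open>p(S)\<close> to the last vector of a block gives nearly orthogonal
  contributions \<open>b\<^sub>j c\<^sup>j\<close>, where the \<open>b\<^sub>j\<close> are the Taylor coefficients of \<open>p\<close> at \<open>l\<close>. Therefore
  \<open>\<parallel>p(q(S))\<parallel>\<^sup>2 \<ge> \<Sum> \<bar>b\<^sub>j c\<^sup>j\<bar>\<^sup>2 \<ge> \<bar>p(l)\<bar>\<^sup>2 + \<bar>b\<^sub>m c\<^sup>m\<bar>\<^sup>2 > \<bar>p(l)\<bar>\<^sup>2\<close>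
  (\<open>calkin_norm_poly_jordan_chains\<close>), because \<open>b\<^sub>m\<close> is the leading coefficient of \<open>p\<close>.
\<close>

section \<open>Polynomials and inverses in complex algebras\<close>

lemma scaleC_zero_left: "0 *\<^sub>C (x :: 'a::complex_vector) = 0"
  using scaleC_add_left[of 0 0 x] by simp

lemma scaleC_minus_left: "(- c) *\<^sub>C (x :: 'a::complex_vector) = - (c *\<^sub>C x)"
  using scaleC_add_left[of "- c" c x] by (simp add: scaleC_zero_left eq_neg_iff_add_eq_0)

lemma scaleC_diff_left: "(b - c) *\<^sub>C (x :: 'a::complex_vector) = b *\<^sub>C x - c *\<^sub>C x"
  using scaleC_add_left[of b "- c" x] by (simp add: scaleC_minus_left)

lemma scaleC_sum_left: "(\<Sum>i\<in>I. f i) *\<^sub>C x = (\<Sum>i\<in>I. f i *\<^sub>C (x :: 'a::complex_vector))"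
  by (induction I rule: infinite_finite_induct) (simp_all add: scaleC_zero_left scaleC_add_left)

lemma power_scaleC: "(c *\<^sub>C (x :: 'a::complex_algebra)) ^ n = c ^ n *\<^sub>C x ^ n"
  by (induction n) (simp_all add: scaleC_one mult_scaleC_left mult_scaleC_right scaleC_scaleC
      power_commutes)

lemma poly_eval_upto:
  assumes "degree p \<le> n"
  shows "poly_eval p (a :: 'a::complex_algebra) = (\<Sum>i\<le>n. coeff p i *\<^sub>C a ^ i)"
  unfolding poly_eval_def
  by (rule sum.mono_neutral_left) (use assms in \<open>auto simp: coeff_eq_0 scaleC_zero_left\<close>)

lemma poly_eval_0: "poly_eval 0 (a :: 'a::complex_algebra) = 0"
  by (simp add: poly_eval_def scaleC_zero_left)

lemma poly_eval_add:
  "poly_eval (p + q) (a :: 'a::complex_algebra) = poly_eval p a + poly_eval q a"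
proof -
  let ?n = "max (degree p) (degree q)"
  show ?thesis
    by (simp add: poly_eval_upto[of _ ?n] degree_add_le_max scaleC_add_left sum.distrib)
qed

lemma poly_eval_pCons:
  "poly_eval (pCons c p) (a :: 'a::complex_algebra) = c *\<^sub>C 1 + a * poly_eval p a"
proof -
  have "poly_eval (pCons c p) a = (\<Sum>i\<le>Suc (degree p). coeff (pCons c p) i *\<^sub>C a ^ i)"
    by (rule poly_eval_upto) (rule degree_pCons_le)
  also have "\<dots> = c *\<^sub>C 1 + a * poly_eval p a"
    by (simp add: sum.atMost_Suc_shift poly_eval_def sum_distrib_left mult_scaleC_right del: sum.atMost_Suc)
  finally show ?thesis .
qed

lemma poly_eval_smult:
  "poly_eval (smult c p) (a :: 'a::complex_algebra) = c *\<^sub>C poly_eval p a"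
  by (induction p) (simp_all add: poly_eval_0 scaleC_zero_right poly_eval_pCons scaleC_add_right
      scaleC_scaleC mult_scaleC_right)

lemma poly_eval_mult:
  "poly_eval (p * q) (a :: 'a::complex_algebra) = poly_eval p a * poly_eval q a"
  by (induction p) (simp_all add: poly_eval_0 poly_eval_add poly_eval_smult poly_eval_pCons
      scaleC_zero_left distrib_right mult_scaleC_left mult.assoc)

lemma poly_eval_translate:
  "poly_eval (p \<circ>\<^sub>p [:l, 1:]) (a - l *\<^sub>C 1) = poly_eval p (a :: 'a::complex_algebra)"
  by (induction p) (simp_all add: poly_eval_0 pcompose_pCons poly_eval_add poly_eval_mult
      poly_eval_smult poly_eval_pCons left_diff_distrib mult_scaleC_left scaleC_zero_left scaleC_one)

definition has_inverse :: "'a::monoid_mult \<Rightarrow> bool"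
  where "has_inverse x \<longleftrightarrow> (\<exists>y. y * x = 1 \<and> x * y = 1)"

lemma in_spectrum_iff: "l \<in> spectrum a \<longleftrightarrow> \<not> has_inverse (a - l *\<^sub>C 1)"
  by (simp add: spectrum_def has_inverse_def)

lemma has_inverse_1: "has_inverse 1"
  by (auto simp: has_inverse_def)

lemma has_inverse_mult:
  assumes "has_inverse x" "has_inverse y"
  shows "has_inverse (x * y)"
proof -
  obtain u v where "u * x = 1" "x * u = 1" "v * y = 1" "y * v = 1"
    using assms by (auto simp: has_inverse_def)
  then have "(v * u) * (x * y) = 1" "(x * y) * (v * u) = 1"
    by (metis mult.assoc mult.right_neutral)+
  then show ?thesis by (auto simp: has_inverse_def)
qed

lemma has_inverse_scaleC:
  assumes "c \<noteq> 0" "has_inverse (x :: 'a::complex_algebra)"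
  shows "has_inverse (c *\<^sub>C x)"
proof -
  obtain u where "u * x = 1" "x * u = 1"
    using assms by (auto simp: has_inverse_def)
  then have "(inverse c *\<^sub>C u) * (c *\<^sub>C x) = 1" "(c *\<^sub>C x) * (inverse c *\<^sub>C u) = 1"
    using assms(1) by (simp_all add: mult_scaleC_left mult_scaleC_right scaleC_scaleC scaleC_one)
  then show ?thesis by (auto simp: has_inverse_def)
qed

lemma geometric_sum_left:
  "(1 - x) * (\<Sum>i<n. x ^ i) = (1 - x ^ n :: 'a::{ring,monoid_mult})"
  by (induction n) (simp_all add: distrib_left left_diff_distrib[of 1 x "x ^ _"])

lemma geometric_sum_right:
  "(\<Sum>i<n. x ^ i) * (1 - x) = (1 - x ^ n :: 'a::{ring,monoid_mult})"
  by (induction n) (simp_all add: distrib_right right_diff_distrib[of "x ^ _" 1 x] power_commutes)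

lemma has_inverse_one_minus_nilpotent:
  "x ^ n = 0 \<Longrightarrow> has_inverse (1 - x :: 'a::{ring,monoid_mult})"
  unfolding has_inverse_def
  using geometric_sum_left[of x n] geometric_sum_right[of x n] by auto

text \<open>Split off one root at a time: every linear factor of \<open>q\<close> becomes an
  invertible element of the algebra.\<close>
lemma has_inverse_poly_eval:
  assumes "q \<noteq> 0" "\<And>l. poly q l = 0 \<Longrightarrow> l \<notin> spectrum a"
  shows "has_inverse (poly_eval q (a :: 'a::complex_algebra))"
  using assms
proof (induction "degree q" arbitrary: q)
  case 0
  then obtain c where c: "q = [:c:]" by (metis degree_eq_zeroE)
  have "has_inverse (c *\<^sub>C (1 :: 'a))"
    using 0(2) c by (intro has_inverse_scaleC has_inverse_1) auto
  then show ?case by (simp add: c poly_eval_pCons poly_eval_0)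
next
  case (Suc n)
  then have "\<not> constant (poly q)" by (simp add: constant_degree)
  then obtain l where l: "poly q l = 0" using fundamental_theorem_of_algebra by blast
  then obtain r where r: "q = [:- l, 1:] * r" by (metis poly_eq_0_iff_dvd dvdE)
  have "r \<noteq> 0" using Suc.prems(1) r by auto
  then have "degree q = Suc (degree r)"
    unfolding r by (subst degree_mult_eq) auto
  then have "has_inverse (poly_eval r a)"
    using Suc \<open>r \<noteq> 0\<close> r by (intro Suc.hyps(1)) auto
  moreover have "has_inverse (a - l *\<^sub>C 1)"
    using Suc.prems(2)[OF l] by (simp add: in_spectrum_iff)
  moreover have "poly_eval q a = (a - l *\<^sub>C 1) * poly_eval r a"
    by (simp add: r poly_eval_mult poly_eval_pCons poly_eval_0 scaleC_minus_left scaleC_one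
        flip: mult_pCons_left del: mult_pCons_left)
  ultimately show ?case by (simp add: has_inverse_mult)
qed

text \<open>This is the inclusion of the spectral mapping theorem that bounds the
  spectral radius of \<open>p(a)\<close>: if \<open>p(a) - m\<close> is not invertible, then one of the linear factors of
  \<open>p - m\<close> is not invertible at \<open>a\<close>.\<close>
lemma spectrum_poly_eval_subset:
  assumes "degree p > 0"
  shows "spectrum (poly_eval p a) \<subseteq> poly p ` spectrum (a :: 'a::complex_algebra)"
proof
  fix m assume m: "m \<in> spectrum (poly_eval p a)"
  have "poly_eval (p + [:- m:]) a = poly_eval p a - m *\<^sub>C 1"
    unfolding poly_eval_add by (simp add: poly_eval_pCons poly_eval_0 scaleC_minus_left)
  then have "\<not> has_inverse (poly_eval (p + [:- m:]) a)"
    using m by (simp add: in_spectrum_iff)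
  moreover have "p + [:- m:] \<noteq> 0"
  proof
    assume "p + [:- m:] = 0"
    then have "p = [:m:]" by (simp add: eq_neg_iff_add_eq_0[symmetric])
    then show False using assms by simp
  qed
  ultimately obtain l where "poly (p + [:- m:]) l = 0" "l \<in> spectrum a"
    using has_inverse_poly_eval by blast
  then show "m \<in> poly p ` spectrum a" by force
qed

section \<open>Normed algebras in which elements near 1 are invertible\<close>

text \<open>The spectral theory below needs completeness only through the last axiom. Stated in this
  form, it passes to a quotient algebra by lifting an element of norm less than \<open>1\<close>.\<close>
class neumann_algebra = complex_algebra + real_normed_algebra +
  assumes scaleR_eq_scaleC: "r *\<^sub>R x = complex_of_real r *\<^sub>C x"
    and norm_scaleC_eq: "norm (c *\<^sub>C x) = cmod c * norm x"
    and neumann: "norm x < 1 \<Longrightarrow> \<exists>y. y * (1 - x) = 1 \<and> (1 - x) * y = 1"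

lemma bounded_bilinear_scaleC:
  "bounded_bilinear ((*\<^sub>C) :: complex \<Rightarrow> 'a \<Rightarrow> 'a::neumann_algebra)"
proof
  show "\<exists>K. \<forall>c x. norm (c *\<^sub>C x :: 'a) \<le> norm c * norm x * K"
    by (intro exI[of _ 1]) (simp add: norm_scaleC_eq)
qed (simp_all add: scaleC_add_left scaleC_add_right scaleR_eq_scaleC scaleC_scaleC
    scaleR_conv_of_real mult.commute)

lemmas continuous_on_scaleC [continuous_intros] =
  bounded_bilinear.continuous_on[OF bounded_bilinear_scaleC]

lemma continuous_on_poly_eval [continuous_intros]:
  "continuous_on A f \<Longrightarrow> continuous_on A (\<lambda>x. poly_eval p (f x :: 'a::neumann_algebra))"
  unfolding poly_eval_def by (intro continuous_intros)

lemma has_inverse_near_1: "norm x < 1 \<Longrightarrow> has_inverse (1 - x :: 'a::neumann_algebra)"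
  using neumann by (auto simp: has_inverse_def)

lemma has_inverse_perturb:
  fixes x :: "'a::neumann_algebra"
  assumes "y * x = 1" "x * y = 1" "norm (y * (x - z)) < 1"
  shows "has_inverse z"
proof -
  have "z = x * (1 - y * (x - z))"
    using assms(2) by (simp add: algebra_simps flip: mult.assoc)
  moreover have "has_inverse x" using assms by (auto simp: has_inverse_def)
  ultimately show ?thesis using has_inverse_mult has_inverse_near_1[OF assms(3)] by metis
qed

lemma open_has_inverse: "open {x :: 'a::neumann_algebra. has_inverse x}"
proof (rule openI)
  fix x :: 'a assume "x \<in> {x. has_inverse x}"
  then obtain y where y: "y * x = 1" "x * y = 1" by (auto simp: has_inverse_def)
  have "ball x (1 / (norm y + 1)) \<subseteq> {x. has_inverse x}"
  proof clarify
    fix z assume "z \<in> ball x (1 / (norm y + 1))"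
    then have "norm (x - z) * (norm y + 1) < 1"
      using norm_ge_zero[of y] by (simp add: dist_norm pos_less_divide_eq add_nonneg_pos)
    moreover have "norm (y * (x - z)) \<le> norm y * norm (x - z)" by (rule norm_mult_ineq)
    ultimately have "norm (y * (x - z)) < 1"
      by (simp add: algebra_simps) (use norm_ge_zero[of "x - z"] in linarith)
    then show "has_inverse z" by (rule has_inverse_perturb[OF y])
  qed
  then show "\<exists>e>0. ball x e \<subseteq> {x. has_inverse x}"
    using norm_ge_zero[of y] by (intro exI[of _ "1 / (norm y + 1)"]) (simp add: add_nonneg_pos)
qed

lemma spectrum_cmod_le:
  assumes "l \<in> spectrum (a :: 'a::neumann_algebra)"
  shows "cmod l \<le> norm a"
proof (rule ccontr)
  assume "\<not> cmod l \<le> norm a"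
  then have l: "norm a < cmod l" by simp
  then have l0: "l \<noteq> 0" using norm_ge_zero[of a] by auto
  have "norm (inverse l *\<^sub>C a) < 1"
    using l l0 by (simp add: norm_scaleC_eq norm_inverse) (simp add: field_simps)
  then have "has_inverse ((- l) *\<^sub>C (1 - inverse l *\<^sub>C a))"
    using l0 by (intro has_inverse_scaleC has_inverse_near_1) auto
  also have "(- l) *\<^sub>C (1 - inverse l *\<^sub>C a) = a - l *\<^sub>C 1"
    using l0 by (simp add: scaleC_minus_left scaleC_diff_right scaleC_scaleC scaleC_one)
  finally show False using assms by (simp add: in_spectrum_iff)
qed

lemma compact_spectrum: "compact (spectrum (a :: 'a::neumann_algebra))"
proof -
  have "open ((\<lambda>l. a - l *\<^sub>C 1) -` {x. has_inverse x})"
    by (intro open_vimage open_has_inverse continuous_intros)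
  moreover have "spectrum a = - ((\<lambda>l. a - l *\<^sub>C 1) -` {x. has_inverse x})"
    by (auto simp: in_spectrum_iff)
  ultimately have "closed (spectrum a)" by (simp add: closed_def)
  moreover have "bounded (spectrum a)"
    using spectrum_cmod_le[of _ a] by (auto simp: bounded_iff)
  ultimately show ?thesis by (simp add: compact_eq_bounded_closed)
qed

lemma norm_mult_power_le:
  "norm (x * y ^ n) \<le> norm x * norm (y :: 'a::{real_normed_algebra,monoid_mult}) ^ n"
proof (induction n)
  case (Suc n)
  have "norm (x * y ^ Suc n) \<le> norm (x * y ^ n) * norm y"
    using norm_mult_ineq[of "x * y ^ n" y] by (simp only: power_Suc2 mult.assoc)
  also have "\<dots> \<le> norm x * norm y ^ n * norm y"
    using Suc by (intro mult_right_mono) auto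
  finally show ?case by (simp add: mult_ac)
qed auto

section \<open>The spectrum is not empty\<close>

text \<open>The proof that the spectrum is nonempty follows Rickart: contour integrals
  of the resolvent are replaced by averages over roots of unity.\<close>
lemma sum_roots_of_unity_power:
  fixes i n :: nat
  assumes "0 < i" "i < n"
  shows "(\<Sum>j<n. cis (2 * pi * j / n) ^ i) = 0"
proof -
  define w where "w = cis (2 * pi * i / n)"
  have "cis (2 * pi * j / n) ^ i = w ^ j" for j :: nat
    by (simp add: w_def Complex.DeMoivre mult_ac)
  moreover have "w ^ n = 1"
    using assms by (simp add: w_def Complex.DeMoivre)
  moreover have "w \<noteq> 1"
  proof
    assume "w = 1"
    then obtain k :: int where "2 * pi * i / n = 2 * pi * k"
      unfolding w_def cis_conv_exp exp_eq_1 by auto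
    then have "real i = real_of_int k * real n" using assms by (simp add: field_simps)
    then have "int i = k * int n" by (metis of_int_eq_iff of_int_mult of_int_of_nat_eq)
    then have "int n dvd int i" by simp
    then show False using assms by (auto dest: dvd_imp_le)
  qed
  ultimately show ?thesis by (simp add: sum_gp_strict)
qed

text \<open>A discrete Cauchy formula. Expanding the resolvent at \<open>z \<omega>\<^sup>j\<close> over the
  common denominator \<open>1 - (z a)\<^sup>n\<close> gives geometric sums, and averaging over \<open>j\<close> keeps only their
  constant terms.\<close>
lemma roots_of_unity_average:
  fixes a :: "'a::neumann_algebra" and n :: nat
  assumes g: "\<And>z. g z * (1 - z *\<^sub>C a) = 1" "\<And>z. (1 - z *\<^sub>C a) * g z = 1" and "n > 0"
  shows "(1 - (z *\<^sub>C a) ^ n) * (inverse (real n) *\<^sub>R (\<Sum>j<n. g (z * cis (2 * pi * j / n)))) = 1"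
proof -
  let ?w = "\<lambda>j. cis (2 * pi * real j / real n)"
  have *: "(1 - (z *\<^sub>C a) ^ n) * g (z * ?w j) = (\<Sum>i<n. (z ^ i * ?w j ^ i) *\<^sub>C a ^ i)" for j
  proof -
    let ?x = "(z * ?w j) *\<^sub>C a"
    have "?w j ^ n = 1" using \<open>n > 0\<close> cis_multiple_2pi[of "real j"] by (simp add: Complex.DeMoivre)
    then have "?x ^ n = (z *\<^sub>C a) ^ n"
      by (simp add: power_scaleC power_mult_distrib)
    then have "(1 - (z *\<^sub>C a) ^ n) * g (z * ?w j) = (\<Sum>i<n. ?x ^ i) * ((1 - ?x) * g (z * ?w j))"
      using geometric_sum_right[of ?x n] by (simp flip: mult.assoc)
    then show ?thesis by (simp add: g power_scaleC power_mult_distrib)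
  qed
  have "(1 - (z *\<^sub>C a) ^ n) * (\<Sum>j<n. g (z * ?w j))
      = (\<Sum>i<n. (z ^ i * (\<Sum>j<n. ?w j ^ i)) *\<^sub>C a ^ i)"
    unfolding sum_distrib_left * scaleC_sum_left by (rule sum.swap)
  also have "\<dots> = (\<Sum>i<n. if i = 0 then real n *\<^sub>R 1 else 0)"
    by (intro sum.cong) (auto simp: sum_roots_of_unity_power scaleC_zero_left scaleR_eq_scaleC)
  also have "\<dots> = real n *\<^sub>R 1" using \<open>n > 0\<close> by simp
  finally show ?thesis using \<open>n > 0\<close> by simp
qed

text \<open>The resolvent identity \<open>g(z) - g(w) = (z - w) g(z) a g(w)\<close> bounds \<open>g\<close>
  near \<open>w\<close> by \<open>2 \<parallel>g(w)\<parallel>\<close>, and then yields continuity.\<close>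
lemma resolvent_continuous:
  fixes a :: "'a::neumann_algebra"
  assumes g: "\<And>z. g z * (1 - z *\<^sub>C a) = 1" "\<And>z. (1 - z *\<^sub>C a) * g z = 1"
  shows "continuous_on UNIV g"
proof -
  have "isCont g w" for w
  proof -
    let ?c = "norm a * norm (g w)"
    have diff: "norm (g z - g w) \<le> cmod (z - w) * norm (g z) * ?c" for z
    proof -
      have "g z - g w = g z * ((1 - w *\<^sub>C a) * g w) - (g z * (1 - z *\<^sub>C a)) * g w"
        by (simp add: g)
      also have "\<dots> = (z - w) *\<^sub>C (g z * (a * g w))"
        by (simp add: algebra_simps mult_scaleC_left mult_scaleC_right scaleC_diff_left)
      finally have "norm (g z - g w) = cmod (z - w) * norm (g z * (a * g w))"
        by (simp add: norm_scaleC_eq)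
      also have "norm (g z * (a * g w)) \<le> norm (g z) * (norm a * norm (g w))"
        by (meson norm_mult_ineq order_trans mult_left_mono norm_ge_zero)
      finally show ?thesis by (simp add: mult_left_mono mult.assoc)
    qed
    have lim: "((\<lambda>z. cmod (z - w) * ?c) \<longlongrightarrow> 0) (at w)"
      by (auto intro!: tendsto_eq_intros)
    then have "\<forall>\<^sub>F z in at w. cmod (z - w) * ?c < 1/2"
      by (rule order_tendstoD) simp
    then have "\<forall>\<^sub>F z in at w. norm (g z - g w) \<le> 2 * norm (g w) * (cmod (z - w) * ?c)"
    proof eventually_elim
      case (elim z)
      have "norm (g z - g w) \<le> norm (g z) * (cmod (z - w) * ?c)"
        using diff[of z] by (simp add: mult_ac)
      moreover have "norm (g z) * (cmod (z - w) * ?c) \<le> norm (g z) * (1/2)"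
        using elim by (intro mult_left_mono) auto
      moreover have "norm (g z) \<le> norm (g w) + norm (g z - g w)"
        by (metis norm_triangle_sub add.commute)
      ultimately have "norm (g z) \<le> 2 * norm (g w)" by linarith
      then have "norm (g z) * (cmod (z - w) * ?c) \<le> 2 * norm (g w) * (cmod (z - w) * ?c)"
        by (intro mult_right_mono) auto
      with \<open>norm (g z - g w) \<le> norm (g z) * (cmod (z - w) * ?c)\<close> show ?case by linarith
    qed
    moreover have "((\<lambda>z. 2 * norm (g w) * (cmod (z - w) * ?c)) \<longlongrightarrow> 0) (at w)"
      using tendsto_mult_left[OF lim, of "2 * norm (g w)"] by simp
    ultimately have "((\<lambda>z. g z - g w) \<longlongrightarrow> 0) (at w)"
      by (rule Lim_null_comparison)
    then show ?thesis by (simp add: isCont_def LIM_zero_iff)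
  qed
  then show ?thesis by (simp add: continuous_on_eq_continuous_at)
qed

text \<open>The averages \<open>G n s\<close> of the resolvent over the circle of radius \<open>s\<close> invert
  \<open>1 - (s a)\<^sup>n\<close> and are equicontinuous in \<open>s\<close>, uniformly in \<open>n\<close>, because the resolvent is uniformly
  continuous on discs. If \<open>(s\<^sub>0 a)\<^sup>n\<close> tends to \<open>0\<close>, then \<open>G n s\<^sub>0\<close> tends to \<open>1\<close>; so for \<open>s\<^sub>1\<close> slightly
  larger \<open>G n s\<^sub>1\<close> stays close to \<open>1\<close>, the powers of \<open>s\<^sub>1 a\<close> are bounded, and those of \<open>s a\<close> tend to
  \<open>0\<close> for all \<open>s < s\<^sub>1\<close>. Steps of fixed length reach every radius.\<close>
lemma quasinilpotent_power_norms:
  fixes a :: "'a::neumann_algebra"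
  assumes "\<And>z. has_inverse (1 - z *\<^sub>C a)" "0 \<le> t"
  shows "(\<lambda>n. t ^ n * norm (a ^ n)) \<longlonglongrightarrow> 0"
proof -
  obtain g where g: "\<And>z. g z * (1 - z *\<^sub>C a) = 1" "\<And>z. (1 - z *\<^sub>C a) * g z = 1"
    using assms(1) unfolding has_inverse_def by metis
  have cont: "continuous_on (cball 0 (t + 1)) g"
    using resolvent_continuous[OF g] continuous_on_subset by blast
  \<comment> \<open>The disc is larger than \<open>t\<close> by \<open>1\<close> so that each step may overshoot the radius it is aimed at.\<close>
  then have "uniformly_continuous_on (cball 0 (t + 1)) g"
    by (rule compact_uniformly_continuous) simp
  then obtain d0 where d0: "d0 > 0"
    "\<And>z w. \<lbrakk>z \<in> cball 0 (t+1); w \<in> cball 0 (t+1); dist w z < d0\<rbrakk> \<Longrightarrow> dist (g w) (g z) < 1/4"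
    unfolding uniformly_continuous_on_def by (metis zero_less_divide_1_iff zero_less_numeral)
  define d where "d = min d0 1"
  have d: "d > 0" "d \<le> 1" "d \<le> d0" using d0(1) by (auto simp: d_def)
  obtain M where M: "\<And>z. z \<in> cball 0 (t+1) \<Longrightarrow> norm (g z) \<le> M"
    using compact_imp_bounded[OF compact_continuous_image[OF cont compact_cball]]
    unfolding bounded_iff by blast
  define G where "G n s = inverse n *\<^sub>R (\<Sum>j<n. g (complex_of_real s * cis (2 * pi * j / n)))"
    for n :: nat and s :: real
  have G: "(1 - (complex_of_real s *\<^sub>C a) ^ n) * G n s = 1" if "n > 0" for n s
    unfolding G_def by (rule roots_of_unity_average[OF g that])
  have norm_pow: "norm ((complex_of_real s *\<^sub>C a) ^ n) = s ^ n * norm (a ^ n)" if "s \<ge> 0" for s n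
    using that by (simp add: power_scaleC norm_scaleC_eq norm_power)
  have average_le: "norm (inverse n *\<^sub>R (\<Sum>j<n. f j)) \<le> c"
    if "\<And>j. j < n \<Longrightarrow> norm (f j) \<le> c" "n > 0" for n c and f :: "nat \<Rightarrow> 'a"
  proof -
    have "norm (\<Sum>j<n. f j) \<le> real n * c"
      using sum_norm_le[of "{..<n}" f "\<lambda>_. c"] that(1) by simp
    then show ?thesis using \<open>n > 0\<close> by (simp add: field_simps)
  qed
  have G_le: "norm (G n s) \<le> M" if "0 \<le> s" "s \<le> t + 1" "n > 0" for n s
    unfolding G_def by (rule average_le) (use that M in \<open>auto simp: norm_mult\<close>)
  have G_diff: "norm (G n s - G n s') \<le> 1/4"
    if "0 \<le> s" "s \<le> t + 1" "0 \<le> s'" "s' \<le> t + 1" "\<bar>s - s'\<bar> < d" "n > 0" for n s s'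
  proof -
    have "G n s - G n s' = inverse n *\<^sub>R (\<Sum>j<n. g (complex_of_real s * cis (2 * pi * j / n))
        - g (complex_of_real s' * cis (2 * pi * j / n)))"
      by (simp add: G_def sum_subtractf scaleR_diff_right)
    also have "norm \<dots> \<le> 1/4"
    proof (rule average_le[OF _ \<open>n > 0\<close>])
      fix j
      let ?w = "cis (2 * pi * real j / real n)"
      have "dist (complex_of_real s * ?w) (complex_of_real s' * ?w) = \<bar>s - s'\<bar>"
        by (simp add: dist_norm norm_mult flip: left_diff_distrib of_real_diff)
      then have "dist (g (complex_of_real s * ?w)) (g (complex_of_real s' * ?w)) < 1/4"
        using that d by (intro d0(2)) (auto simp: norm_mult)
      then show "norm (g (complex_of_real s * ?w) - g (complex_of_real s' * ?w)) \<le> 1/4"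
        by (simp add: dist_norm)
    qed
    finally show ?thesis .
  qed
  have step: "(\<lambda>n. s ^ n * norm (a ^ n)) \<longlonglongrightarrow> 0"
    if s: "0 \<le> s0" "s0 \<le> t" "0 \<le> s" "s \<le> t" "s \<le> s0 + d / 2"
      and lim: "(\<lambda>n. s0 ^ n * norm (a ^ n)) \<longlonglongrightarrow> 0" for s s0
  proof (cases "s \<le> s0")
    case True
    then show ?thesis
      using s by (intro Lim_null_comparison[OF _ lim] always_eventually)
        (auto intro!: mult_right_mono power_mono)
  next
    case False
    \<comment> \<open>The radius \<open>s1\<close> leaves room above \<open>s\<close>: bounded powers at \<open>s1\<close> force decay at \<open>s\<close>.\<close>
    define s1 where "s1 = s + d / 4"
    have s1: "s < s1" "s1 \<le> t + 1" "\<bar>s1 - s0\<bar> < d" "0 < s1"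
      using s d False by (auto simp: s1_def abs_if)
    have "(\<lambda>n. s0 ^ n * norm (a ^ n) * M) \<longlonglongrightarrow> 0"
      using tendsto_mult_right[OF lim, of M] by simp
    then have "\<forall>\<^sub>F n in sequentially. s0 ^ n * norm (a ^ n) * M < 1/4"
      by (rule order_tendstoD) simp
    then have "\<forall>\<^sub>F n in sequentially. norm (s ^ n * norm (a ^ n)) \<le> (s / s1) ^ n * (3 * norm (1::'a))"
      using eventually_gt_at_top[of 0]
    proof eventually_elim
      case (elim n)
      have "G n s0 - 1 = (complex_of_real s0 *\<^sub>C a) ^ n * G n s0"
        using G[OF elim(2), of s0] by (simp add: left_diff_distrib diff_eq_eq add.commute)
      then have "norm (G n s0 - 1) \<le> norm ((complex_of_real s0 *\<^sub>C a) ^ n * G n s0)"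
        by simp
      also have "\<dots> \<le> s0 ^ n * norm (a ^ n) * M"
        using norm_mult_ineq[of "(complex_of_real s0 *\<^sub>C a) ^ n" "G n s0"] G_le[of s0 n] s elim(2)
        by (simp add: norm_pow) (smt (verit) mult_left_mono mult_nonneg_nonneg norm_ge_zero zero_le_power)
      finally have "norm (G n s0 - 1) < 1/4" using elim(1) by simp
      moreover have "norm (G n s1 - G n s0) \<le> 1/4"
        using s s1 elim(2) d by (intro G_diff) auto
      ultimately have near: "norm (G n s1 - 1) \<le> 1/2"
        using norm_triangle_ineq[of "G n s1 - G n s0" "G n s0 - 1"] by simp
      let ?v = "1 - (complex_of_real s1 *\<^sub>C a) ^ n"
      have "?v = 1 - ?v * (G n s1 - 1)"
        using G[OF elim(2), of s1] by (simp add: right_diff_distrib)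
      then have "norm ?v \<le> norm (1::'a) + norm (?v * (G n s1 - 1))"
        by (metis norm_triangle_ineq4)
      also have "norm (?v * (G n s1 - 1)) \<le> norm ?v * (1/2)"
        using near norm_mult_ineq[of ?v "G n s1 - 1"]
        by (meson order_trans mult_left_mono norm_ge_zero)
      finally have "norm ?v \<le> 2 * norm (1::'a)" by simp
      then have "norm ((complex_of_real s1 *\<^sub>C a) ^ n) \<le> 3 * norm (1::'a)"
        using norm_triangle_ineq4[of 1 ?v] by simp
      then have "s1 ^ n * norm (a ^ n) \<le> 3 * norm (1::'a)"
        using s1 by (simp add: norm_pow)
      then have "(s / s1) ^ n * (s1 ^ n * norm (a ^ n)) \<le> (s / s1) ^ n * (3 * norm (1::'a))"
        using s s1 by (intro mult_left_mono) auto
      then show ?case using s s1 by (simp add: power_divide)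
    qed
    moreover have "(\<lambda>n. (s / s1) ^ n * (3 * norm (1::'a))) \<longlonglongrightarrow> 0"
      using s s1 by (intro tendsto_mult_left_zero LIMSEQ_realpow_zero) auto
    ultimately show ?thesis by (rule Lim_null_comparison)
  qed
  have "(\<lambda>n. s ^ n * norm (a ^ n)) \<longlonglongrightarrow> 0" if "0 \<le> s" "s \<le> t" "s \<le> k * (d / 2)" for k :: nat and s
    using that
  proof (induction k arbitrary: s)
    case 0
    then have "s = 0" by simp
    then show ?case
      by (intro tendsto_eventually eventually_sequentiallyI[of 1]) (auto simp: power_0_left)
  next
    case (Suc k)
    define s0 where "s0 = max 0 (s - d / 2)"
    show ?case
    proof (rule step[of s0])
      show "(\<lambda>n. s0 ^ n * norm (a ^ n)) \<longlonglongrightarrow> 0"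
        using Suc d by (intro Suc.IH) (auto simp: s0_def max_def algebra_simps)
    qed (use Suc d in \<open>auto simp: s0_def\<close>)
  qed
  moreover obtain k :: nat where "t / (d / 2) \<le> k" using real_arch_simple by blast
  ultimately show ?thesis using assms(2) d(1) by (simp add: field_simps)
qed

text \<open>If the spectrum were empty, then \<open>a\<close> would have an inverse \<open>b\<close> and
  \<open>\<parallel>1\<parallel> \<le> \<parallel>a\<^sup>n\<parallel> \<parallel>b\<parallel>\<^sup>n\<close>. This contradicts the decay of the power norms of \<open>a\<close>.\<close>
theorem spectrum_nonempty:
  assumes "(1 :: 'a::neumann_algebra) \<noteq> 0"
  shows "spectrum (a :: 'a) \<noteq> {}"
proof
  assume empty: "spectrum a = {}"
  then have inv: "has_inverse (a - l *\<^sub>C 1)" for l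
    using in_spectrum_iff[of l a] by auto
  have "has_inverse (1 - z *\<^sub>C a)" for z
  proof (cases "z = 0")
    case True
    then show ?thesis by (simp add: scaleC_zero_left has_inverse_1)
  next
    case False
    then have "1 - z *\<^sub>C a = (- z) *\<^sub>C (a - inverse z *\<^sub>C 1)"
      by (simp add: scaleC_minus_left scaleC_diff_right scaleC_scaleC scaleC_one)
    then show ?thesis using inv False by (simp add: has_inverse_scaleC)
  qed
  moreover obtain b where b: "a * b = 1" "b * a = 1"
    using inv[of 0] by (auto simp: has_inverse_def scaleC_zero_left)
  ultimately have "(\<lambda>n. norm b ^ n * norm (a ^ n)) \<longlonglongrightarrow> 0"
    by (intro quasinilpotent_power_norms) auto
  moreover have "norm (1::'a) \<le> norm b ^ n * norm (a ^ n)" for n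
  proof -
    have "a ^ n * b ^ n = 1"
    proof (induction n)
      case (Suc n)
      have "a ^ Suc n * b ^ Suc n = a ^ n * (a * b) * b ^ n"
        by (simp only: power_Suc2[of a] power_Suc[of b] mult.assoc)
      then show ?case using Suc b by simp
    qed simp
    then show ?thesis using norm_mult_power_le[of "a ^ n" b n] by (simp add: mult.commute)
  qed
  ultimately have "norm (1::'a) \<le> 0"
    by (intro LIMSEQ_le_const) auto
  then show False using assms by simp
qed

section \<open>Semicontinuity of the spectral radius and boundary points of the spectrum\<close>

lemma spectral_radius_le:
  assumes "(1 :: 'a::neumann_algebra) \<noteq> 0" "\<And>l. l \<in> spectrum (a :: 'a) \<Longrightarrow> cmod l \<le> c"
  shows "spectral_radius a \<le> c"
  unfolding spectral_radius_def
  using spectrum_nonempty[OF assms(1), of a] assms(2) by (intro cSup_least) auto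

lemma spectral_radius_ge:
  assumes "l \<in> spectrum (a :: 'a::neumann_algebra)"
  shows "cmod l \<le> spectral_radius a"
  unfolding spectral_radius_def
  using assms spectrum_cmod_le[of _ a] by (intro cSup_upper bdd_aboveI[of _ "norm a"]) auto

text \<open>Choose \<open>r\<close> strictly between the spectral radius and the norm. The
  compact annulus \<open>r \<le> \<bar>l\<bar> \<le> \<parallel>a\<parallel> + 1\<close> misses the spectrum of \<open>a\<close>, so by the tube lemma it misses the
  spectra of all nearby elements; scalars beyond
  the outer radius exceed the norm of such an element and cannot lie in its spectrum.\<close>
lemma open_spectral_radius_less_norm:
  assumes "(1 :: 'a::neumann_algebra) \<noteq> 0"
  shows "open {a :: 'a. spectral_radius a < norm a}"
proof (subst open_subopen, clarify)
  fix a :: 'a assume "spectral_radius a < norm a"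
  then obtain r where r: "spectral_radius a < r" "r < norm a" using dense by blast
  define K where "K = {l. r \<le> cmod l} \<inter> cball 0 (norm a + 1)"
  have "compact K"
    unfolding K_def by (intro closed_Int_compact closed_Collect_le continuous_intros) auto
  define W where "W = (\<lambda>(b :: 'a, l). b - l *\<^sub>C 1) -` {x. has_inverse x}"
  have "open W"
    unfolding W_def case_prod_unfold by (intro open_vimage open_has_inverse continuous_intros)
  have sub: "{a} \<times> K \<subseteq> W"
  proof clarify
    fix l assume "l \<in> K"
    then have "l \<notin> spectrum a" using spectral_radius_ge[of l a] r by (auto simp: K_def)
    then show "(a, l) \<in> W" by (simp add: W_def in_spectrum_iff)
  qed
  obtain U where U: "open U" "a \<in> U" "U \<times> K \<subseteq> W"
    using Elementary_Topology.tube_lemma[OF \<open>compact K\<close> \<open>open W\<close> sub] by blast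
  let ?V = "U \<inter> {b. norm b < norm a + 1} \<inter> {b. r < norm b}"
  have "open ?V"
    using U(1) by (intro open_Int open_Collect_less continuous_intros) auto
  moreover have "?V \<subseteq> {a. spectral_radius a < norm a}"
  proof clarify
    fix b assume b: "b \<in> U" "norm b < norm a + 1" "r < norm b"
    have "cmod l \<le> r" if "l \<in> spectrum b" for l
    proof (rule ccontr)
      assume "\<not> cmod l \<le> r"
      then have "l \<in> K" using spectrum_cmod_le[OF that] b by (simp add: K_def)
      then have "(b, l) \<in> W" using U b by blast
      then show False using that by (simp add: W_def in_spectrum_iff)
    qed
    then show "spectral_radius b < norm b"
      using spectral_radius_le[OF assms, of b r] b by force
  qed
  ultimately show "\<exists>T. open T \<and> a \<in> T \<and> T \<subseteq> {a. spectral_radius a < norm a}"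
    using U r by (intro exI[of _ ?V]) auto
qed

text \<open>The inverses of \<open>a - m\<close> blow up as \<open>m\<close> approaches \<open>l\<close> from outside
  the spectrum, since otherwise \<open>a - l\<close> would be a small perturbation of an invertible element. Such
  an inverse serves as \<open>u\<close>.\<close>
lemma spectrum_boundary_zero_divisor:
  fixes a :: "'a::neumann_algebra"
  assumes "l \<in> spectrum a" "l \<in> closure (- spectrum a)" "\<eta> > 0"
  shows "\<exists>u. norm ((a - l *\<^sub>C 1) * u) < \<eta> * norm u"
proof -
  define d where "d = \<eta> / (2 * (norm (1::'a) + 1))"
  have pos: "norm (1::'a) + 1 > 0" by (simp add: add_nonneg_pos)
  have d: "d > 0" using assms(3) pos by (simp add: d_def)
  obtain m where m: "m \<notin> spectrum a" "dist m l < d"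
    using assms(2) d by (auto simp: closure_approachable)
  then obtain u where u: "u * (a - m *\<^sub>C 1) = 1" "(a - m *\<^sub>C 1) * u = 1"
    by (auto simp: in_spectrum_iff has_inverse_def)
  have "\<not> norm (u * ((a - m *\<^sub>C 1) - (a - l *\<^sub>C 1))) < 1"
    using has_inverse_perturb[OF u] assms(1) by (auto simp: in_spectrum_iff)
  also have "u * ((a - m *\<^sub>C 1) - (a - l *\<^sub>C 1)) = (l - m) *\<^sub>C u"
    by (simp add: scaleC_diff_left mult_scaleC_right algebra_simps)
  finally have ge: "1 \<le> cmod (l - m) * norm u" by (simp add: norm_scaleC_eq)
  have lt: "cmod (l - m) < d" using m(2) by (simp add: dist_norm norm_minus_commute)
  have u0: "norm u > 0" using ge by (cases "u = 0") auto
  have "(a - l *\<^sub>C 1) * u = 1 + (m - l) *\<^sub>C u"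
    using u(2) by (simp add: algebra_simps mult_scaleC_left scaleC_diff_left)
  then have "norm ((a - l *\<^sub>C 1) * u) \<le> norm (1::'a) + cmod (l - m) * norm u"
    using norm_triangle_ineq[of 1 "(m - l) *\<^sub>C u"] by (simp add: norm_scaleC_eq norm_minus_commute)
  also have "norm (1::'a) \<le> norm (1::'a) * (cmod (l - m) * norm u)"
    using mult_left_mono[OF ge, of "norm (1::'a)"] by simp
  also have "norm (1::'a) * (cmod (l - m) * norm u) + cmod (l - m) * norm u
      = (cmod (l - m) * (norm (1::'a) + 1)) * norm u"
    by (simp add: algebra_simps)
  also have "cmod (l - m) * (norm (1::'a) + 1) < \<eta>"
  proof -
    have "cmod (l - m) * (norm (1::'a) + 1) < d * (norm (1::'a) + 1)"
      using lt pos by (rule mult_strict_right_mono)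
    also have "\<dots> = \<eta> / 2" using pos by (simp add: d_def field_simps)
    finally show ?thesis using assms(3) by simp
  qed
  finally show ?thesis using u0 by auto
qed

lemma poly_max_in_closure_compl:
  assumes "degree p > 0" "l \<in> A" "\<And>z. z \<in> A \<Longrightarrow> cmod (poly p z) \<le> cmod (poly p l)"
  shows "l \<in> closure (- A)"
proof (rule ccontr)
  assume "l \<notin> closure (- A)"
  then have l: "l \<in> interior A" by (simp add: closure_complement)
  have "poly p constant_on UNIV"
    by (rule maximum_modulus_principle[of _ _ "interior A" l])
      (use l assms(3) interior_subset in \<open>auto intro!: holomorphic_intros\<close>)
  then have "constant (poly p)" by (auto simp: constant_on_def Fundamental_Theorem_Algebra.constant_def)
  then show False using assms(1) by (simp add: constant_degree)
qed

section \<open>Orthonormal families in complex Hilbert spaces\<close>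

lemma cinner_add_right: "cinner z (x + y) = cinner z x + cinner z y"
  by (metis cinner_add_left cinner_commute complex_cnj_add)

lemma cinner_scaleC_right: "cinner x (a *\<^sub>C y) = cnj a * cinner x y"
  by (metis cinner_commute cinner_scaleC_left complex_cnj_mult)

lemma cinner_zero_left: "cinner 0 x = 0"
  using cinner_add_left[of 0 0 x] by simp

lemma cinner_zero_right: "cinner x 0 = 0"
  using cinner_add_right[of x 0 0] by simp

lemma cinner_diff_left: "cinner (x - y) z = cinner x z - cinner y z"
  using cinner_add_left[of "x - y" y z] by simp

lemma cinner_sum_left: "cinner (\<Sum>i\<in>I. f i) z = (\<Sum>i\<in>I. cinner (f i) z)"
  by (induction I rule: infinite_finite_induct) (simp_all add: cinner_zero_left cinner_add_left)

lemma cinner_sum_right: "cinner z (\<Sum>i\<in>I. f i) = (\<Sum>i\<in>I. cinner z (f i))"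
  by (induction I rule: infinite_finite_induct) (simp_all add: cinner_zero_right cinner_add_right)

lemma cinner_scaleR_left: "cinner (r *\<^sub>R x) y = complex_of_real r * cinner x y"
  by (simp add: scaleR_scaleC cinner_scaleC_left)

lemma pythagoras:
  assumes "cinner x y = 0"
  shows "(norm (x + y))\<^sup>2 = (norm x)\<^sup>2 + (norm y)\<^sup>2"
proof -
  have "cinner y x = 0" using assms cinner_commute[of y x] by simp
  then have "cinner (x + y) (x + y) = cinner x x + cinner y y"
    using assms by (simp add: cinner_add_left cinner_add_right)
  then have "complex_of_real ((norm (x + y))\<^sup>2) = complex_of_real ((norm x)\<^sup>2 + (norm y)\<^sup>2)"
    by (simp only: cinner_self of_real_add)
  then show ?thesis by (simp only: of_real_eq_iff)
qed

definition orthonormal :: "('i \<Rightarrow> 'a::complex_hilbert_space) \<Rightarrow> 'i set \<Rightarrow> bool"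
  where "orthonormal e I \<longleftrightarrow> (\<forall>i\<in>I. \<forall>j\<in>I. cinner (e i) (e j) = (if i = j then 1 else 0))"

lemma orthonormal_cinner:
  "orthonormal e I \<Longrightarrow> i \<in> I \<Longrightarrow> j \<in> I \<Longrightarrow> cinner (e i) (e j) = (if i = j then 1 else 0)"
  by (simp add: orthonormal_def)

lemma orthonormal_norm: 
  assumes "orthonormal e I" "i \<in> I"
  shows "norm (e i) = 1"
proof -
  have "complex_of_real ((norm (e i))\<^sup>2) = complex_of_real 1"
    using orthonormal_cinner[OF assms assms(2)] by (simp only: cinner_self[symmetric]) simp
  then have "(norm (e i))\<^sup>2 = 1" by (simp only: of_real_eq_iff)
  then show ?thesis using norm_ge_zero[of "e i"] by (auto simp: power2_eq_1_iff simp del: norm_ge_zero)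
qed

lemma orthonormal_compose:
  "orthonormal e I \<Longrightarrow> inj_on f J \<Longrightarrow> f ` J \<subseteq> I \<Longrightarrow> orthonormal (\<lambda>j. e (f j)) J"
  by (auto simp: orthonormal_def inj_on_def image_subset_iff)

lemma orthonormal_subset: "orthonormal e I \<Longrightarrow> J \<subseteq> I \<Longrightarrow> orthonormal e J"
  unfolding orthonormal_def by blast

lemma norm_orthonormal_sum:
  assumes "finite I" "orthonormal e I"
  shows "(norm (\<Sum>i\<in>I. c i *\<^sub>C e i))\<^sup>2 = (\<Sum>i\<in>I. (cmod (c i))\<^sup>2)"
  using assms
proof (induction I)
  case (insert j I)
  have "cinner (c j *\<^sub>C e j) (\<Sum>i\<in>I. c i *\<^sub>C e i) = 0"
    using insert.hyps insert.prems
    by (auto simp: cinner_sum_right cinner_scaleC_left cinner_scaleC_right orthonormal_def intro!: sum.neutral)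
  moreover have "norm (e j) = 1" using insert.prems by (rule orthonormal_norm) simp
  moreover have "orthonormal e I" using insert.prems by (rule orthonormal_subset) auto
  ultimately show ?case
    using insert by (simp add: pythagoras norm_scaleC)
qed simp

lemma orthonormal_residual:
  assumes "finite I" "orthonormal e I" "j \<in> I"
  shows "cinner (x - (\<Sum>i\<in>I. cinner x (e i) *\<^sub>C e i)) (e j) = 0"
proof -
  have "(\<Sum>i\<in>I. cinner x (e i) * cinner (e i) (e j)) = (\<Sum>i\<in>I. if i = j then cinner x (e i) else 0)"
    using assms by (intro sum.cong) (auto simp: orthonormal_def)
  then show ?thesis
    using assms by (simp add: cinner_diff_left cinner_sum_left cinner_scaleC_left)
qed

lemma bessel_equality:
  assumes "finite I" "orthonormal e I"
  shows "(norm x)\<^sup>2 = (norm (x - (\<Sum>i\<in>I. cinner x (e i) *\<^sub>C e i)))\<^sup>2 + (\<Sum>i\<in>I. (cmod (cinner x (e i)))\<^sup>2)"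
proof -
  let ?p = "\<Sum>i\<in>I. cinner x (e i) *\<^sub>C e i"
  have "cinner (x - ?p) ?p = 0"
    using orthonormal_residual[OF assms]
    by (simp add: cinner_sum_right[of "x - _"] cinner_scaleC_right)
  from pythagoras[OF this] show ?thesis by (simp add: norm_orthonormal_sum[OF assms])
qed

lemma cinner_le_norm: "cmod (cinner x y) \<le> norm x * norm y"
proof (cases "y = 0")
  case False
  let ?u = "inverse (norm y) *\<^sub>R y"
  have "cinner ?u ?u = complex_of_real ((norm ?u)\<^sup>2)" by (rule cinner_self)
  also have "norm ?u = 1" using False by simp
  finally have "orthonormal (\<lambda>_::unit. ?u) {()}" by (simp add: orthonormal_def)
  from bessel_equality[OF _ this, of x] have "(cmod (cinner x ?u))\<^sup>2 \<le> (norm x)\<^sup>2" by simp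
  then have "cmod (cinner x ?u) \<le> norm x" by (simp add: abs_le_square_iff[symmetric])
  moreover have "cmod (cinner x ?u) = cmod (cinner x y) / norm y"
    by (simp add: scaleR_scaleC cinner_scaleC_right norm_mult norm_inverse divide_inverse)
  ultimately have "cmod (cinner x y) / norm y \<le> norm x" by simp
  then show ?thesis using False by (simp add: pos_divide_le_eq)
qed (simp add: cinner_zero_right)

lemma bounded_linear_cinner_left: "bounded_linear (\<lambda>x. cinner x y)"
  by (rule bounded_linear_intro[where K = "norm y"])
    (simp_all add: cinner_add_left cinner_scaleR_left scaleR_conv_of_real cinner_le_norm)

text \<open>Recursive choice: a property that can be met by a unit vector orthogonal to
  any given finite orthonormal family can be met along an orthonormal sequence.\<close>
lemma orthonormal_sequence_exists:
  fixes Q :: "nat \<Rightarrow> 'a::complex_hilbert_space \<Rightarrow> bool"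
  assumes "\<And>n e. orthonormal e {..<n} \<Longrightarrow>
    \<exists>x. norm x = 1 \<and> (\<forall>i<n. cinner x (e i) = 0) \<and> Q n x"
  obtains e where "orthonormal e (UNIV :: nat set)" "\<And>n. Q n (e n)"
proof -
  define P where "P e n x \<longleftrightarrow> norm x = 1 \<and> (\<forall>i<n. cinner x (e i) = 0) \<and> Q n x"
    for e and n :: nat and x :: 'a
  have onI: "orthonormal e A" if P: "\<And>k. k \<in> A \<Longrightarrow> P e k (e k)" 
    and A: "\<And>i j. j \<in> A \<Longrightarrow> i < j \<Longrightarrow> i \<in> A" for e A
    unfolding orthonormal_def
  proof (intro ballI)
    fix i j assume ij: "i \<in> A" "j \<in> A"
    then have n: "norm (e i) = 1" "norm (e j) = 1" using P by (auto simp: P_def)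
    consider "i < j" | "j < i" | "i = j" by linarith
    then show "cinner (e i) (e j) = (if i = j then 1 else 0)"
    proof cases
      case 1
      then have "cinner (e j) (e i) = 0" using P[OF ij(2)] by (simp add: P_def)
      then show ?thesis using 1 cinner_commute[of "e i" "e j"] by simp
    next
      case 2
      then show ?thesis using P[OF ij(1)] by (simp add: P_def)
    next
      case 3
      then show ?thesis using n by (simp add: cinner_self)
    qed
  qed
  have "\<exists>e. \<forall>n. P e n (e n)"
  proof (rule dependent_wellorder_choice)
    fix r :: 'a and f g :: "nat \<Rightarrow> 'a" and n
    assume "\<And>y. y < n \<Longrightarrow> f y = g y"
    then show "P f n r = P g n r" by (simp add: P_def)
  next
    fix n and e :: "nat \<Rightarrow> 'a" assume "\<And>k. k < n \<Longrightarrow> P e k (e k)"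
    then have "orthonormal e {..<n}" by (intro onI) auto
    then show "\<exists>x. P e n x" unfolding P_def by (rule assms)
  qed
  then obtain e where e: "\<And>n. P e n (e n)" by blast
  then have "orthonormal e UNIV" by (intro onI) auto
  moreover have "Q n (e n)" for n using e[of n] by (simp add: P_def)
  ultimately show ?thesis by (rule that)
qed

lemma infinite_dimensional_unit_orthogonal:
  fixes e :: "'i \<Rightarrow> 'h::complex_hilbert_space"
  assumes "\<not> finite_dimensional TYPE('h)" "finite I" "orthonormal e I"
  shows "\<exists>x. norm x = 1 \<and> (\<forall>i\<in>I. cinner x (e i) = 0)"
proof (rule ccontr)
  assume none: "\<not> ?thesis"
  interpret cv: vector_space "(*\<^sub>C) :: complex \<Rightarrow> 'h \<Rightarrow> 'h" by (rule vector_space_scaleC)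
  have "x \<in> cv.span (e ` I)" for x
  proof -
    let ?p = "\<Sum>i\<in>I. cinner x (e i) *\<^sub>C e i"
    have "x = ?p"
    proof (rule ccontr)
      assume "x \<noteq> ?p"
      then have "norm (inverse (norm (x - ?p)) *\<^sub>R (x - ?p)) = 1" by simp
      moreover have "\<forall>i\<in>I. cinner (inverse (norm (x - ?p)) *\<^sub>R (x - ?p)) (e i) = 0"
        using orthonormal_residual[OF assms(2,3), of _ x] by (simp add: cinner_scaleR_left)
      ultimately show False using none by blast
    qed
    moreover have "?p \<in> cv.span (e ` I)"
      by (intro cv.span_sum cv.span_scale cv.span_base) auto
    ultimately show ?thesis by simp
  qed
  then have "cv.span (e ` I) = UNIV" by auto
  then show False using assms(1,2) unfolding finite_dimensional_def by blast
qed

section \<open>Bounded operators\<close>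

lemma norm_bop_apply: "norm (bop_apply T x) \<le> norm T * norm x"
  by transfer (rule norm_blinfun)

lemma norm_bop_le:
  "0 \<le> K \<Longrightarrow> (\<And>x. norm (bop_apply T x) \<le> K * norm x) \<Longrightarrow> norm T \<le> K"
  by transfer (rule norm_blinfun_bound)

lemma bop_eqI: "(\<And>x. bop_apply S x = bop_apply T x) \<Longrightarrow> S = T"
  by transfer (rule blinfun_eqI)

lemma bop_apply_sum: "bop_apply (\<Sum>i\<in>I. T i) x = (\<Sum>i\<in>I. bop_apply (T i) x)"
  by (induction I rule: infinite_finite_induct) (simp_all add: bop_apply_simps)

lemma bop_apply_scaleC: "bop_apply T (c *\<^sub>C x) = c *\<^sub>C bop_apply T x"
  by transfer simp

lemmas bop_apply_linear =
  linear_add[OF bounded_linear.linear[OF bounded_linear_bop_apply]]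
  linear_diff[OF bounded_linear.linear[OF bounded_linear_bop_apply]]
  linear_sum[OF bounded_linear.linear[OF bounded_linear_bop_apply]]
  linear_0[OF bounded_linear.linear[OF bounded_linear_bop_apply]]
  linear_scale[OF bounded_linear.linear[OF bounded_linear_bop_apply]]

definition bop_of :: "('a \<Rightarrow> 'a) \<Rightarrow> 'a::complex_hilbert_space bop"
  where "bop_of f = Bop (Blinfun f)"

lemma bop_of_apply:
  fixes f :: "'a \<Rightarrow> 'a::complex_hilbert_space"
  assumes "\<And>x y. f (x + y) = f x + f y" "\<And>c x. f (c *\<^sub>C x) = c *\<^sub>C f x"
    "\<And>x. norm (f x) \<le> norm x * K"
  shows "bop_apply (bop_of f) = f"
proof -
  have f: "bounded_linear f"
    by (rule bounded_linear_intro[where K = K]) (simp_all add: assms scaleR_scaleC)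
  then show ?thesis
    by (simp add: bop_of_def bop_apply.rep_eq Bop_inverse bounded_linear_Blinfun_apply assms(2))
qed

text \<open>Complex linearity survives pointwise limits, so the space of complex-linear
  operators is closed among all bounded real-linear ones.\<close>
instance bop :: (complex_hilbert_space) banach
proof
  fix X :: "nat \<Rightarrow> 'a bop" assume X: "Cauchy X"
  let ?r = "blinfun_of_bop :: 'a bop \<Rightarrow> _"
  have dist: "dist (?r S) (?r T) = dist S T" for S T
    by (simp add: dist_norm minus_bop.rep_eq[symmetric] norm_bop.rep_eq[symmetric])
  have "Cauchy (\<lambda>n. ?r (X n))" using X by (simp add: Cauchy_def dist)
  then obtain L where L: "(\<lambda>n. ?r (X n)) \<longlonglongrightarrow> L"
    using convergent_eq_Cauchy convergent_def by blast
  have lim: "(\<lambda>n. blinfun_apply (?r (X n)) x) \<longlonglongrightarrow> blinfun_apply L x" for x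
    using L by (intro tendsto_intros)
  have "blinfun_apply L (c *\<^sub>C x) = c *\<^sub>C blinfun_apply L x" for c x
  proof (rule LIMSEQ_unique[OF lim])
    have "(\<lambda>n. c *\<^sub>C blinfun_apply (?r (X n)) x) \<longlonglongrightarrow> c *\<^sub>C blinfun_apply L x"
      by (rule bounded_linear.tendsto[OF bounded_linear_scaleC lim])
    moreover have "blinfun_apply (?r (X n)) (c *\<^sub>C x) = c *\<^sub>C blinfun_apply (?r (X n)) x" for n
      using blinfun_of_bop[of "X n"] by blast
    ultimately show "(\<lambda>n. blinfun_apply (?r (X n)) (c *\<^sub>C x)) \<longlonglongrightarrow> c *\<^sub>C blinfun_apply L x"
      by simp
  qed
  then have "?r (Bop L) = L" by (simp add: Bop_inverse)
  then have "(\<lambda>n. ?r (X n)) \<longlonglongrightarrow> ?r (Bop L)" using L by simp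
  then have "X \<longlonglongrightarrow> Bop L"
    unfolding tendsto_dist_iff[of _ "?r (Bop L)"] tendsto_dist_iff[of X] by (simp add: dist)
  then show "convergent X" by (auto simp: convergent_def)
qed

definition rank_one :: "'a \<Rightarrow> 'a \<Rightarrow> 'a::complex_hilbert_space bop"
  where "rank_one f g = bop_of (\<lambda>x. cinner x f *\<^sub>C g)"

lemma rank_one_apply: "bop_apply (rank_one f g) x = cinner x f *\<^sub>C g"
  unfolding rank_one_def
  by (subst bop_of_apply[where K = "norm f * norm g"])
    (auto simp: cinner_add_left scaleC_add_left cinner_scaleC_left scaleC_scaleC norm_scaleC
      mult.assoc[symmetric] cinner_le_norm intro!: mult_right_mono)

lemma compact_op_rank_one: "compact_op (rank_one f g)"
proof (rule compact_opI)
  have "bounded_linear (\<lambda>c. c *\<^sub>C g)"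
    by (rule bounded_linear_intro[where K = "norm g"])
      (simp_all add: scaleC_add_left scaleR_scaleC scaleC_scaleC scaleR_conv_of_real norm_scaleC)
  then show "compact ((\<lambda>c. c *\<^sub>C g) ` cball 0 (norm f))"
    by (intro compact_continuous_image linear_continuous_on) auto
  fix x :: 'a assume "norm x \<le> 1"
  then have "cmod (cinner x f) \<le> norm f"
    using cinner_le_norm[of x f] mult_right_mono[of "norm x" 1 "norm f"] by simp
  then show "bop_apply (rank_one f g) x \<in> (\<lambda>c. c *\<^sub>C g) ` cball 0 (norm f)"
    by (auto simp: rank_one_apply)
qed

lemma compact_op_sum: "(\<And>i. i \<in> I \<Longrightarrow> compact_op (T i)) \<Longrightarrow> compact_op (\<Sum>i\<in>I. T i)"
  by (induction I rule: infinite_finite_induct) (simp_all add: compact_op_0 compact_op_add)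

definition span_proj :: "('i \<Rightarrow> 'a) \<Rightarrow> 'i set \<Rightarrow> 'a::complex_hilbert_space bop"
  where "span_proj e I = (\<Sum>i\<in>I. rank_one (e i) (e i))"

lemma span_proj_apply: "bop_apply (span_proj e I) x = (\<Sum>i\<in>I. cinner x (e i) *\<^sub>C e i)"
  by (simp add: span_proj_def bop_apply_sum rank_one_apply)

lemma compact_op_span_proj: "compact_op (span_proj e I)"
  unfolding span_proj_def by (intro compact_op_sum compact_op_rank_one)

section \<open>Norms in the Calkin algebra\<close>

text \<open>Otherwise the images of a subsequence converge to some \<open>y \<noteq> 0\<close>. The sum of
  \<open>N\<close> of its vectors has norm \<open>\<surd>N\<close>, whereas the image of the sum has norm comparable to
  \<open>N \<parallel>y\<parallel>\<close>. This contradicts boundedness.\<close>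
lemma compact_op_orthonormal_tendsto_0:
  assumes "compact_op K" "orthonormal e (UNIV :: nat set)"
  shows "(\<lambda>n. bop_apply K (e n)) \<longlonglongrightarrow> 0"
proof (rule ccontr)
  assume "\<not> ?thesis"
  then obtain r where r: "r > 0" "\<forall>N. \<exists>n\<ge>N. r \<le> norm (bop_apply K (e n))"
    unfolding LIMSEQ_iff by (auto simp: not_less)
  then have "infinite {n. r \<le> norm (bop_apply K (e n))}"
    by (auto simp: infinite_nat_iff_unbounded_le)
  then obtain f :: "nat \<Rightarrow> nat" where f: "strict_mono f" "\<And>n. r \<le> norm (bop_apply K (e (f n)))"
    using infinite_enumerate by blast
  obtain C where C: "compact C" "\<And>x. norm x \<le> 1 \<Longrightarrow> bop_apply K x \<in> C"
    using assms(1) by (rule compact_opE) blast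
  have "\<forall>n. bop_apply K (e (f n)) \<in> C"
    using C(2) orthonormal_norm[OF assms(2)] by simp
  then obtain y g where g: "strict_mono (g :: nat \<Rightarrow> nat)" "((\<lambda>n. bop_apply K (e (f n))) \<circ> g) \<longlonglongrightarrow> y"
    using C(1) unfolding compact_def by metis
  define x where "x n = e (f (g n))" for n
  have lim: "(\<lambda>n. bop_apply K (x n)) \<longlonglongrightarrow> y" using g(2) by (simp add: x_def o_def)
  have "inj (\<lambda>n. f (g n))"
    using f(1) g(1) by (auto simp: inj_def strict_mono_eq)
  then have x: "orthonormal x UNIV"
    unfolding x_def by (rule orthonormal_compose[OF assms(2)]) auto
  have "r \<le> norm (bop_apply K (x n))" for n using f(2) by (simp add: x_def)
  then have y: "r \<le> norm y"
    by (intro LIMSEQ_le_const[OF tendsto_norm[OF lim]]) blast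
  obtain m where m: "\<And>n. n \<ge> m \<Longrightarrow> norm (bop_apply K (x n) - y) < r / 2"
    using lim r(1) unfolding LIMSEQ_iff by (meson half_gt_zero)
  have bound: "real N * (r / 2)\<^sup>2 \<le> (norm K)\<^sup>2" if "N > 0" for N :: nat
  proof -
    let ?s = "\<Sum>n<N. x (m + n)"
    have "orthonormal (\<lambda>n. x (m + n)) {..<N}"
      using x by (rule orthonormal_compose) auto
    then have s: "(norm ?s)\<^sup>2 = real N"
      using norm_orthonormal_sum[of "{..<N}" "\<lambda>n. x (m + n)" "\<lambda>_. 1"] by (simp add: scaleC_one)
    have "real N *\<^sub>R y - bop_apply K ?s = (\<Sum>n<N. y - bop_apply K (x (m + n)))"
      by (simp add: bop_apply_linear sum_subtractf sum_constant_scaleR)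
    also have "norm \<dots> \<le> (\<Sum>n<N. r / 2)"
      using m by (intro sum_norm_le) (auto simp: norm_minus_commute less_imp_le)
    finally have "norm (real N *\<^sub>R y - bop_apply K ?s) \<le> real N * (r / 2)" by simp
    moreover have "real N * norm y \<le> norm (real N *\<^sub>R y - bop_apply K ?s) + norm (bop_apply K ?s)"
      using norm_triangle_sub[of "real N *\<^sub>R y" "bop_apply K ?s"] by simp
    moreover have "real N * r \<le> real N * norm y" using y by (rule mult_left_mono) simp
    ultimately have "real N * (r / 2) \<le> norm (bop_apply K ?s)" by simp
    also have "\<dots> \<le> norm K * norm ?s" by (rule norm_bop_apply)
    finally have "(real N * (r / 2))\<^sup>2 \<le> (norm K * norm ?s)\<^sup>2"
      using r(1) by (intro power_mono) auto
    also have "(real N * (r / 2))\<^sup>2 = real N * (real N * (r / 2)\<^sup>2)"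
      by (simp add: power2_eq_square)
    also have "(norm K * norm ?s)\<^sup>2 = real N * (norm K)\<^sup>2"
      by (simp add: power_mult_distrib s)
    finally show ?thesis using that by (simp only: mult_le_cancel_left_pos of_nat_0_less_iff)
  qed
  obtain N :: nat where "(norm K)\<^sup>2 / (r / 2)\<^sup>2 < real N" using reals_Archimedean2 by blast
  moreover have pos: "(r / 2)\<^sup>2 > 0" using r(1) by simp
  ultimately have "(norm K)\<^sup>2 < real N * (r / 2)\<^sup>2" by (simp only: pos_divide_less_eq)
  moreover have "real N * (r / 2)\<^sup>2 \<le> (norm K)\<^sup>2" if "N = 0" using that by simp
  ultimately show False using bound[of N] by force
qed

text \<open>A compact perturbation of \<open>A\<close> changes the limit along an orthonormal
  sequence by \<open>0\<close>.\<close>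
lemma calkin_norm_ge_orthonormal_limit:
  assumes "orthonormal e (UNIV :: nat set)" "(\<lambda>n. norm (bop_apply A (e n))) \<longlonglongrightarrow> c"
  shows "c \<le> norm (calkin_proj A)"
proof (rule norm_calkin_greatest)
  fix T assume "calkin_proj T = calkin_proj A"
  then have "compact_op (T - A)" by (simp add: calkin_proj_eq_iff)
  then have lim: "(\<lambda>n. norm (bop_apply A (e n)) - norm (bop_apply (T - A) (e n))) \<longlonglongrightarrow> c - norm (0::'a)"
    using assms by (intro tendsto_diff tendsto_norm compact_op_orthonormal_tendsto_0)
  have "norm (bop_apply A (e n)) - norm (bop_apply (T - A) (e n)) \<le> norm T" for n
  proof -
    have "norm (bop_apply A (e n)) - norm (bop_apply (T - A) (e n)) \<le> norm (bop_apply T (e n))"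
      using norm_triangle_ineq4[of "bop_apply T (e n)" "bop_apply (T - A) (e n)"]
      by (simp add: bop_apply_simps)
    also have "\<dots> \<le> norm T * norm (e n)" by (rule norm_bop_apply)
    finally show ?thesis using orthonormal_norm[OF assms(1)] by simp
  qed
  then have "c - norm (0::'a) \<le> norm T" by (intro LIMSEQ_le_const2[OF lim]) blast
  then show "c \<le> norm T" by simp
qed

text \<open>Precomposing \<open>B\<close> with the projection onto the orthogonal complement of the
  family is a finite-rank perturbation.\<close>
lemma calkin_norm_le_finite_codim:
  assumes "finite I" "orthonormal e I" "0 \<le> c"
    "\<And>x. (\<And>i. i \<in> I \<Longrightarrow> cinner x (e i) = 0) \<Longrightarrow> norm (bop_apply B x) \<le> c * norm x"
  shows "norm (calkin_proj B) \<le> c"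
proof -
  let ?P = "span_proj e I"
  have "B - B * (1 - ?P) = B * ?P" by (simp add: right_diff_distrib)
  then have "calkin_proj B = calkin_proj (B * (1 - ?P))"
    by (simp add: calkin_proj_eq_iff compact_op_mult_left compact_op_span_proj)
  also have "norm \<dots> \<le> norm (B * (1 - ?P))" by (rule norm_calkin_proj_le)
  also have "\<dots> \<le> c"
  proof (rule norm_bop_le[OF assms(3)])
    fix x
    let ?y = "x - (\<Sum>i\<in>I. cinner x (e i) *\<^sub>C e i)"
    have "(norm ?y)\<^sup>2 \<le> (norm x)\<^sup>2"
      using bessel_equality[OF assms(1,2), of x] by (simp add: sum_nonneg)
    then have "norm ?y \<le> norm x" by (simp add: abs_le_square_iff[symmetric])
    moreover have "norm (bop_apply B ?y) \<le> c * norm ?y"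
      by (intro assms(4) orthonormal_residual assms(1,2))
    ultimately have "norm (bop_apply B ?y) \<le> c * norm x"
      using assms(3) by (meson mult_left_mono order_trans)
    then show "norm (bop_apply (B * (1 - ?P)) x) \<le> c * norm x"
      by (simp add: bop_apply_simps span_proj_apply)
  qed
  finally show ?thesis .
qed

lemma orthonormal_sequence_norm_greater:
  assumes "0 \<le> c" "c < norm (calkin_proj B)"
  obtains e where "orthonormal e (UNIV :: nat set)" "\<And>n. c < norm (bop_apply B (e n))"
proof (rule orthonormal_sequence_exists[of "\<lambda>_ x. c < norm (bop_apply B x)"])
  fix n and e :: "nat \<Rightarrow> 'a" assume e: "orthonormal e {..<n}"
  have "\<not> (\<forall>x. (\<forall>i\<in>{..<n}. cinner x (e i) = 0) \<longrightarrow> norm (bop_apply B x) \<le> c * norm x)"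
    using calkin_norm_le_finite_codim[OF _ e assms(1), of B] assms(2) by auto
  then obtain x where x: "\<And>i. i < n \<Longrightarrow> cinner x (e i) = 0" "c * norm x < norm (bop_apply B x)"
    by (auto simp: not_le)
  have "x \<noteq> 0" using x(2) by (auto simp: bop_apply_linear)
  then show "\<exists>x. norm x = 1 \<and> (\<forall>i<n. cinner x (e i) = 0) \<and> c < norm (bop_apply B x)"
    using x by (intro exI[of _ "inverse (norm x) *\<^sub>R x"])
      (simp add: cinner_scaleR_left bop_apply_linear field_simps)
qed (rule that)

lemma calkin_proj_arith:
  "calkin_proj 0 = 0" "calkin_proj 1 = 1"
  "calkin_proj (S + T) = calkin_proj S + calkin_proj T"
  "calkin_proj (S - T) = calkin_proj S - calkin_proj T"
  "calkin_proj (S * T) = calkin_proj S * calkin_proj T"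
  "calkin_proj (c *\<^sub>C T) = c *\<^sub>C calkin_proj T"
  by (simp_all add: zero_calkin.abs_eq one_calkin.abs_eq plus_calkin.abs_eq minus_calkin.abs_eq
      times_calkin.abs_eq scaleC_calkin.abs_eq)

lemma calkin_proj_power: "calkin_proj (T ^ n) = calkin_proj T ^ n"
  by (induction n) (simp_all add: calkin_proj_arith)

lemma calkin_proj_sum: "calkin_proj (\<Sum>i\<in>I. T i) = (\<Sum>i\<in>I. calkin_proj (T i))"
  by (induction I rule: infinite_finite_induct) (simp_all add: calkin_proj_arith)

lemma calkin_proj_poly_eval: "calkin_proj (poly_eval p T) = poly_eval p (calkin_proj T)"
  by (simp add: poly_eval_def calkin_proj_sum calkin_proj_arith calkin_proj_power)

lemma continuous_on_calkin_proj: "continuous_on A calkin_proj"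
proof -
  have "dist (calkin_proj S) (calkin_proj T) \<le> dist S T" for S T
    unfolding dist_norm calkin_proj_arith(4)[symmetric] by (rule norm_calkin_proj_le)
  then show ?thesis unfolding continuous_on_iff by (metis order_le_less_trans)
qed

lemma calkin_one_neq_zero:
  assumes "\<not> finite_dimensional TYPE('h::complex_hilbert_space)"
  shows "(1 :: 'h calkin) \<noteq> 0"
proof
  assume "(1 :: 'h calkin) = 0"
  then have "compact_op (1 :: 'h bop)"
    using calkin_proj_eq_iff[of "1 :: 'h bop" 0] by (simp add: calkin_proj_arith)
  have "\<exists>e :: nat \<Rightarrow> 'h. orthonormal e UNIV"
  proof (rule orthonormal_sequence_exists[of "\<lambda>_ (_ :: 'h). True"])
    fix n and e :: "nat \<Rightarrow> 'h" assume "orthonormal e {..<n}"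
    from infinite_dimensional_unit_orthogonal[OF assms _ this]
    show "\<exists>x. norm x = 1 \<and> (\<forall>i<n. cinner x (e i) = 0) \<and> True" by auto
  qed blast
  then obtain e :: "nat \<Rightarrow> 'h" where e: "orthonormal e UNIV" by blast
  have "(\<lambda>n. norm (bop_apply 1 (e n))) \<longlonglongrightarrow> norm (0::'h)"
    by (intro tendsto_norm compact_op_orthonormal_tendsto_0 e \<open>compact_op 1\<close>)
  moreover have "norm (bop_apply 1 (e n)) = 1" for n
    using orthonormal_norm[OF e] by (simp add: bop_apply_simps)
  ultimately show False by (simp add: LIMSEQ_const_iff)
qed

section \<open>Approximate eigenvectors\<close>

text \<open>Lift \<open>u\<close> to an operator \<open>U\<close>. Its Calkin norm is seen along an orthonormal
  sequence \<open>y\<close>, and there \<open>S U\<close> is small up to a compact term, which vanishes in the limit. The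
  component of \<open>U y\<^sub>n\<close> along the given family also vanishes, as it comes from a finite-rank operator.
  What remains of \<open>U y\<^sub>n\<close>, normalised, is the required vector.\<close>
lemma calkin_zero_divisor_orthogonal:
  assumes "\<And>\<eta>. \<eta> > 0 \<Longrightarrow> \<exists>u. norm (calkin_proj S * u) < \<eta> * norm u"
    and I: "finite I" "orthonormal e I" and "\<delta> > 0"
  shows "\<exists>x. norm x = 1 \<and> (\<forall>i\<in>I. cinner x (e i) = 0) \<and> norm (bop_apply S x) \<le> \<delta>"
proof -
  define \<eta> where "\<eta> = \<delta> / 8"
  have \<eta>: "\<eta> > 0" using assms(4) by (simp add: \<eta>_def)
  then obtain u where u: "norm (calkin_proj S * u) < \<eta> * norm u" using assms(1) by blast
  obtain U where U: "calkin_proj U = u" using calkin_proj_surj by blast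
  define c where "c = norm u / 2"
  have "0 < \<eta> * norm u" using u norm_ge_zero le_less_trans by blast
  then have c: "c > 0" using \<eta> by (simp add: c_def zero_less_mult_iff)
  obtain y where y: "orthonormal y (UNIV :: nat set)" "\<And>n. c < norm (bop_apply U (y n))"
    by (rule orthonormal_sequence_norm_greater[of c U]) (use c in \<open>auto simp: U c_def\<close>)
  obtain D where D: "calkin_proj D = calkin_proj S * u" "norm D < \<eta> * norm u"
    using norm_calkin_approx[of "\<eta> * norm u - norm (calkin_proj S * u)" "calkin_proj S * u"] u
    by auto
  define K where "K = S * U - D"
  have K: "compact_op K"
    using D(1) U by (simp add: K_def calkin_proj_eq_iff[symmetric] calkin_proj_arith)
  let ?P = "span_proj e I"
  have lim1: "(\<lambda>n. bop_apply (?P * U) (y n)) \<longlonglongrightarrow> 0"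
    by (intro compact_op_orthonormal_tendsto_0 y compact_op_mult_right compact_op_span_proj)
  have lim2: "(\<lambda>n. bop_apply K (y n)) \<longlonglongrightarrow> 0"
    by (intro compact_op_orthonormal_tendsto_0 y K)
  have "(\<lambda>n. norm D + norm (bop_apply K (y n)) + norm S * norm (bop_apply (?P * U) (y n)))
      \<longlonglongrightarrow> norm D + norm (0::'a) + norm S * norm (0::'a)"
    by (intro tendsto_intros lim1 lim2)
  moreover have "norm D < 3 * c * \<eta>"
  proof -
    have "norm D < 2 * (c * \<eta>)" using D(2) by (simp add: c_def mult.commute)
    then show ?thesis using mult_pos_pos[OF c \<eta>] by simp
  qed
  ultimately have "\<forall>\<^sub>F n in sequentially.
      norm D + norm (bop_apply K (y n)) + norm S * norm (bop_apply (?P * U) (y n)) < 3 * c * \<eta>"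
    by (intro order_tendstoD) auto
  moreover have "\<forall>\<^sub>F n in sequentially. norm (bop_apply (?P * U) (y n)) < c / 2"
    using tendsto_norm[OF lim1] c by (intro order_tendstoD) auto
  ultimately have "\<forall>\<^sub>F n in sequentially.
      norm D + norm (bop_apply K (y n)) + norm S * norm (bop_apply (?P * U) (y n)) < 3 * c * \<eta>
      \<and> norm (bop_apply (?P * U) (y n)) < c / 2"
    by (rule eventually_conj)
  then obtain n where n:
    "norm D + norm (bop_apply K (y n)) + norm S * norm (bop_apply (?P * U) (y n)) < 3 * c * \<eta>"
    "norm (bop_apply (?P * U) (y n)) < c / 2"
    using eventually_happens'[OF sequentially_bot] by blast
  define z where "z = bop_apply U (y n)"
  define w where "w = z - bop_apply ?P z"
  have Pz: "bop_apply (?P * U) (y n) = bop_apply ?P z" by (simp add: z_def bop_apply_simps)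
  have "norm z \<le> norm w + norm (bop_apply ?P z)"
    using norm_triangle_ineq[of w "bop_apply ?P z"] by (simp add: w_def)
  then have w: "c / 2 < norm w" using y(2)[of n] n(2) by (simp add: z_def[symmetric] Pz)
  have "bop_apply S w = bop_apply D (y n) + bop_apply K (y n) - bop_apply S (bop_apply ?P z)"
    by (simp add: w_def K_def z_def bop_apply_simps bop_apply_linear)
  then have "norm (bop_apply S w)
      \<le> norm (bop_apply D (y n)) + norm (bop_apply K (y n)) + norm (bop_apply S (bop_apply ?P z))"
    by (metis norm_triangle_ineq norm_triangle_ineq4 add_right_mono order_trans)
  moreover have "norm (bop_apply D (y n)) \<le> norm D"
    using norm_bop_apply[of D "y n"] orthonormal_norm[OF y(1)] by simp
  moreover have "norm (bop_apply S (bop_apply ?P z)) \<le> norm S * norm (bop_apply ?P z)"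
    by (rule norm_bop_apply)
  ultimately have "norm (bop_apply S w) < 3 * c * \<eta>" using n(1) by (simp add: Pz)
  also have "\<dots> \<le> \<delta> * norm w"
  proof -
    have "3 * c * \<eta> = (3/4) * (\<delta> * (c / 2))" by (simp add: \<eta>_def)
    also have "\<dots> \<le> \<delta> * (c / 2)" using assms(4) c by simp
    also have "\<dots> \<le> \<delta> * norm w" using w assms(4) by simp
    finally show ?thesis .
  qed
  finally have "norm (bop_apply S w) < \<delta> * norm w" .
  moreover have "cinner w (e i) = 0" if "i \<in> I" for i
    using orthonormal_residual[OF I that, of z] by (simp add: w_def span_proj_apply)
  moreover have "w \<noteq> 0" using w c by auto
  ultimately show ?thesis
    by (intro exI[of _ "inverse (norm w) *\<^sub>R w"])
      (simp add: cinner_scaleR_left bop_apply_linear field_simps)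
qed

section \<open>Truncated shifts\<close>

lemma summable_orthonormal_series:
  assumes "orthonormal e (UNIV :: nat set)" "summable (\<lambda>n. (cmod (c n))\<^sup>2)"
  shows "summable (\<lambda>n. c n *\<^sub>C e n)"
  unfolding summable_Cauchy
proof (intro allI impI)
  fix r :: real assume "r > 0"
  then have "r\<^sup>2 > 0" by simp
  then obtain N where N: "\<And>m n. m \<ge> N \<Longrightarrow> norm (\<Sum>k=m..<n. (cmod (c k))\<^sup>2) < r\<^sup>2"
    using assms(2) unfolding summable_Cauchy by meson
  have "norm (\<Sum>k=m..<n. c k *\<^sub>C e k) < r" if "m \<ge> N" for m n
  proof -
    have "(norm (\<Sum>k=m..<n. c k *\<^sub>C e k))\<^sup>2 < r\<^sup>2"
      using N[OF that, of n] norm_orthonormal_sum[of "{m..<n}" e c]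
        orthonormal_subset[OF assms(1)] by (simp add: sum_nonneg)
    then show ?thesis using \<open>r > 0\<close> by (simp add: power2_less_imp_less)
  qed
  then show "\<exists>N. \<forall>m\<ge>N. \<forall>n. norm (\<Sum>k=m..<n. c k *\<^sub>C e k) < r" by blast
qed

definition shift_coeff where
  "shift_coeff e d x n = (if d n then cinner x (e (Suc n)) else 0)"

text \<open>The backward shift along \<open>e\<close>, sending \<open>e\<^sub>n\<^sub>+\<^sub>1\<close> to \<open>e\<^sub>n\<close> if \<open>d n\<close> holds and to \<open>0\<close> otherwise;
  it vanishes on the orthogonal complement of the sequence. The predicate \<open>d\<close> marks the links of the
  Jordan chains.\<close>
definition shift_op :: "(nat \<Rightarrow> 'a) \<Rightarrow> (nat \<Rightarrow> bool) \<Rightarrow> 'a::complex_hilbert_space bop"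
  where "shift_op e d = bop_of (\<lambda>x. \<Sum>n. shift_coeff e d x n *\<^sub>C e n)"

context
  fixes e :: "nat \<Rightarrow> 'a::complex_hilbert_space" and d :: "nat \<Rightarrow> bool"
  assumes e: "orthonormal e UNIV"
begin

lemma shift_coeff_square_sum_le: "(\<Sum>n<k. (cmod (shift_coeff e d x n))\<^sup>2) \<le> (norm x)\<^sup>2"
proof -
  have "(\<Sum>n<k. (cmod (shift_coeff e d x n))\<^sup>2) \<le> (\<Sum>n<k. (cmod (cinner x (e (Suc n))))\<^sup>2)"
    by (intro sum_mono) (simp add: shift_coeff_def)
  also have "orthonormal (\<lambda>n. e (Suc n)) {..<k}"
    using e by (rule orthonormal_compose) auto
  then have "(\<Sum>n<k. (cmod (cinner x (e (Suc n))))\<^sup>2) \<le> (norm x)\<^sup>2"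
    using bessel_equality[of "{..<k}" "\<lambda>n. e (Suc n)" x] by simp
  finally show ?thesis .
qed

lemma shift_series_summable: "summable (\<lambda>n. shift_coeff e d x n *\<^sub>C e n)"
  by (rule summable_orthonormal_series[OF e],
      rule summableI_nonneg_bounded[OF _ shift_coeff_square_sum_le]) simp

lemma shift_series_norm_le: "norm (\<Sum>n. shift_coeff e d x n *\<^sub>C e n) \<le> norm x"
proof (rule LIMSEQ_le_const2[OF tendsto_norm[OF summable_LIMSEQ[OF shift_series_summable]]])
  have "(norm (\<Sum>n<k. shift_coeff e d x n *\<^sub>C e n))\<^sup>2 \<le> (norm x)\<^sup>2" for k
    using shift_coeff_square_sum_le[of x k] orthonormal_subset[OF e]
    by (simp add: norm_orthonormal_sum)
  then have "norm (\<Sum>n<k. shift_coeff e d x n *\<^sub>C e n) \<le> norm x" for k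
    by (rule power2_le_imp_le) simp
  then show "\<exists>N. \<forall>k\<ge>N. norm (\<Sum>n<k. shift_coeff e d x n *\<^sub>C e n) \<le> norm x" by blast
qed

lemma shift_op_apply: "bop_apply (shift_op e d) x = (\<Sum>n. shift_coeff e d x n *\<^sub>C e n)"
proof -
  have "bop_apply (shift_op e d) = (\<lambda>x. \<Sum>n. shift_coeff e d x n *\<^sub>C e n)"
    unfolding shift_op_def
  proof (rule bop_of_apply[where K = 1])
    fix x y :: 'a and c :: complex
    have "shift_coeff e d (x + y) n *\<^sub>C e n
        = shift_coeff e d x n *\<^sub>C e n + shift_coeff e d y n *\<^sub>C e n" for n
      by (simp add: shift_coeff_def cinner_add_left scaleC_add_left[symmetric])
    then show "(\<Sum>n. shift_coeff e d (x + y) n *\<^sub>C e n)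
        = (\<Sum>n. shift_coeff e d x n *\<^sub>C e n) + (\<Sum>n. shift_coeff e d y n *\<^sub>C e n)"
      by (simp add: suminf_add shift_series_summable)
    have "shift_coeff e d (c *\<^sub>C x) n *\<^sub>C e n = c *\<^sub>C (shift_coeff e d x n *\<^sub>C e n)" for n
      by (simp add: shift_coeff_def cinner_scaleC_left scaleC_scaleC)
    then show "(\<Sum>n. shift_coeff e d (c *\<^sub>C x) n *\<^sub>C e n) = c *\<^sub>C (\<Sum>n. shift_coeff e d x n *\<^sub>C e n)"
      by (simp add: bounded_linear.suminf[OF bounded_linear_scaleC] shift_series_summable)
    show "norm (\<Sum>n. shift_coeff e d x n *\<^sub>C e n) \<le> norm x * 1"
      by (simp add: shift_series_norm_le)
  qed
  then show ?thesis by simp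
qed

lemma shift_op_sums: "(\<lambda>n. shift_coeff e d x n *\<^sub>C e n) sums bop_apply (shift_op e d) x"
  unfolding shift_op_apply by (rule summable_sums) (rule shift_series_summable)

lemma norm_shift_op: "norm (shift_op e d) \<le> 1"
  by (rule norm_bop_le) (auto simp: shift_op_apply shift_series_norm_le)

lemma cinner_shift_op: "cinner (bop_apply (shift_op e d) x) (e n) = shift_coeff e d x n"
proof (rule sums_unique2)
  show "(\<lambda>k. cinner (shift_coeff e d x k *\<^sub>C e k) (e n)) sums cinner (bop_apply (shift_op e d) x) (e n)"
    by (rule bounded_linear.sums[OF bounded_linear_cinner_left shift_op_sums])
  have "(\<lambda>k. cinner (shift_coeff e d x k *\<^sub>C e k) (e n)) = (\<lambda>k. if k = n then shift_coeff e d x k else 0)"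
    using orthonormal_cinner[OF e] by (auto simp: cinner_scaleC_left)
  then show "(\<lambda>k. cinner (shift_coeff e d x k *\<^sub>C e k) (e n)) sums shift_coeff e d x n"
    using sums_single[of n "shift_coeff e d x"] by simp
qed

lemma shift_op_eq_0: 
  assumes "\<And>n. shift_coeff e d x n = 0"
  shows "bop_apply (shift_op e d) x = 0"
  using assms unfolding shift_op_apply by (simp add: scaleC_zero_left)

lemma shift_op_basis: "d n \<Longrightarrow> bop_apply (shift_op e d) (e (Suc n)) = e n"
proof (rule sums_unique2[OF shift_op_sums])
  assume "d n"
  then have "(\<lambda>k. shift_coeff e d (e (Suc n)) k *\<^sub>C e k) = (\<lambda>k. if k = n then e k else 0)"
    using orthonormal_cinner[OF e]
    by (auto simp: shift_coeff_def scaleC_zero_left scaleC_one)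
  then show "(\<lambda>k. shift_coeff e d (e (Suc n)) k *\<^sub>C e k) sums e n"
    using sums_single[of n e] by simp
qed

lemma cinner_shift_op_power:
  "cinner (bop_apply (shift_op e d ^ j) x) (e n) =
    (if \<forall>i<j. d (n + i) then cinner x (e (n + j)) else 0)"
proof (induction j arbitrary: n)
  case (Suc j)
  have "(\<forall>i<Suc j. d (n + i)) \<longleftrightarrow> d n \<and> (\<forall>i<j. d (Suc n + i))"
    by (auto simp: less_Suc_eq_0_disj)
  then show ?case
    by (auto simp: bop_apply_simps cinner_shift_op shift_coeff_def Suc)
qed (simp add: bop_apply_simps)

text \<open>A power of the shift keeps a basis vector only if it crosses no broken link, and every
  \<open>m + 1\<close> consecutive steps cross one.\<close>
lemma shift_op_nilpotent:
  assumes "\<And>n. \<exists>i\<le>m. \<not> d (n + i)"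
  shows "shift_op e d ^ Suc m = 0"
proof (rule bop_eqI)
  fix x
  have "bop_apply (shift_op e d) (bop_apply (shift_op e d ^ m) x) = 0"
  proof (rule shift_op_eq_0)
    fix n
    have "\<not> (\<forall>i<Suc m. d (n + i))" using assms[of n] by (auto simp: less_Suc_eq_le)
    then have "cinner (bop_apply (shift_op e d ^ Suc m) x) (e n) = 0"
      unfolding cinner_shift_op_power by (simp only: if_False)
    then show "shift_coeff e d (bop_apply (shift_op e d ^ m) x) n = 0"
      by (simp add: bop_apply_simps cinner_shift_op)
  qed
  then show "bop_apply (shift_op e d ^ Suc m) x = bop_apply 0 x" by (simp add: bop_apply_simps)
qed

text \<open>The product is the norm limit of its finite-rank truncations.\<close>
lemma compact_op_mult_shift_op:
  assumes "\<And>n. norm (bop_apply S (e n)) \<le> (1/2) ^ n"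
  shows "compact_op (S * shift_op e d)"
proof (rule compact_op_limit)
  fix r :: real assume "r > 0"
  have "(\<lambda>k. 2 * (1/2::real) ^ k) \<longlonglongrightarrow> 2 * 0"
    by (intro tendsto_mult tendsto_const LIMSEQ_realpow_zero) auto
  then have "\<forall>\<^sub>F k in sequentially. 2 * (1/2::real) ^ k < r"
    using \<open>r > 0\<close> by (intro order_tendstoD) auto
  then obtain k where k: "2 * (1/2::real) ^ k < r"
    using eventually_happens'[OF sequentially_bot] by blast
  define K where "K = (\<Sum>n<k. rank_one (e (Suc n)) (if d n then bop_apply S (e n) else 0))"
  have "norm (S * shift_op e d - K) \<le> 2 * (1/2) ^ k"
  proof (rule norm_bop_le)
    fix x
    let ?f = "\<lambda>n. shift_coeff e d x n *\<^sub>C bop_apply S (e n)"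
    have "?f sums bop_apply S (bop_apply (shift_op e d) x)"
      using bounded_linear.sums[OF bounded_linear_bop_apply shift_op_sums]
      by (simp add: bop_apply_scaleC)
    then have "(\<lambda>n. ?f (n + k)) sums (bop_apply S (bop_apply (shift_op e d) x) - (\<Sum>n<k. ?f n))"
      by (rule sums_split_initial_segment)
    also have "(\<Sum>n<k. ?f n) = bop_apply K x"
      unfolding K_def bop_apply_sum rank_one_apply
      by (intro sum.cong) (auto simp: shift_coeff_def scaleC_zero_left scaleC_zero_right)
    finally have "(\<lambda>n. ?f (n + k)) sums bop_apply (S * shift_op e d - K) x"
      by (simp add: bop_apply_simps)
    moreover have "(\<lambda>n. (1/2) ^ k * norm x * (1/2) ^ n) sums ((1/2) ^ k * norm x * (1 / (1 - 1/2)))"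
      by (intro sums_mult geometric_sums) auto
    moreover have "norm (?f (n + k)) \<le> (1/2) ^ k * norm x * (1/2) ^ n" for n
    proof -
      have "cmod (shift_coeff e d x (n + k)) \<le> norm x"
        using cinner_le_norm[of x "e (Suc (n + k))"] orthonormal_norm[OF e]
        by (simp add: shift_coeff_def)
      then have "norm (?f (n + k)) \<le> norm x * (1/2) ^ (n + k)"
        unfolding norm_scaleC using assms by (intro mult_mono) auto
      then show ?thesis by (simp add: power_add mult_ac)
    qed
    ultimately have "norm (bop_apply (S * shift_op e d - K) x) \<le> (1/2) ^ k * norm x * (1 / (1 - 1/2))"
      by (metis (no_types, lifting) norm_sums_le)
    then show "norm (bop_apply (S * shift_op e d - K) x) \<le> 2 * (1/2) ^ k * norm x" by simp
  qed simp
  moreover have "compact_op K"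
    unfolding K_def by (intro compact_op_sum compact_op_rank_one)
  ultimately show "\<exists>K. compact_op K \<and> norm (S * shift_op e d - K) < r"
    using k by (intro exI[of _ K]) auto
qed

end

section \<open>The Calkin algebra and its invertible elements\<close>

lemma bop_neumann:
  fixes C :: "'a::complex_hilbert_space bop"
  assumes "norm C < 1"
  shows "\<exists>y. y * (1 - C) = 1 \<and> (1 - C) * y = 1"
proof -
  have le: "norm (C ^ n) \<le> norm (1 :: 'a bop) * norm C ^ n" for n
    by (rule norm_mult_power_le[of 1, simplified])
  have "summable (\<lambda>n. norm (1 :: 'a bop) * norm C ^ n)"
    using assms by (intro summable_mult summable_geometric) simp
  then have summable: "summable (\<lambda>n. C ^ n)"
    by (rule summable_comparison_test'[where N = 0]) (rule le)
  then have sums: "(\<lambda>n. \<Sum>i<n. C ^ i) \<longlonglongrightarrow> (\<Sum>n. C ^ n)" by (rule summable_LIMSEQ)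
  have lim: "(\<lambda>n. 1 - C ^ n) \<longlonglongrightarrow> 1 - 0"
    using summable by (intro tendsto_intros summable_LIMSEQ_zero)
  have "(\<lambda>n. (\<Sum>i<n. C ^ i) * (1 - C)) \<longlonglongrightarrow> (\<Sum>n. C ^ n) * (1 - C)"
    by (intro tendsto_mult sums tendsto_const)
  then have "(\<Sum>n. C ^ n) * (1 - C) = 1 - 0"
    using lim unfolding geometric_sum_right by (rule LIMSEQ_unique)
  moreover have "(\<lambda>n. (1 - C) * (\<Sum>i<n. C ^ i)) \<longlonglongrightarrow> (1 - C) * (\<Sum>n. C ^ n)"
    by (intro tendsto_mult sums tendsto_const)
  then have "(1 - C) * (\<Sum>n. C ^ n) = 1 - 0"
    using lim unfolding geometric_sum_left by (rule LIMSEQ_unique)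
  ultimately show ?thesis by auto
qed

text \<open>Applying the hypothesis to \<open>c\<close> and to its inverse gives both inequalities.\<close>
lemma scaleC_homogeneousI:
  fixes f :: "'a::complex_vector \<Rightarrow> real"
  assumes "\<And>c x. c \<noteq> 0 \<Longrightarrow> f (c *\<^sub>C x) \<le> cmod c * f x" "c \<noteq> 0"
  shows "f (c *\<^sub>C x) = cmod c * f x"
proof (rule antisym)
  have "f x \<le> cmod (inverse c) * f (c *\<^sub>C x)"
    using assms(1)[of "inverse c" "c *\<^sub>C x"] assms(2) by (simp add: scaleC_scaleC scaleC_one)
  from mult_left_mono[OF this, of "cmod c"] show "cmod c * f x \<le> f (c *\<^sub>C x)"
    using assms(2) by (simp add: norm_inverse mult.assoc[symmetric])
qed (use assms in auto)

lemma norm_scaleC_bop: "norm (c *\<^sub>C T) = cmod c * norm (T :: 'a::complex_hilbert_space bop)"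
proof -
  have le: "norm (c *\<^sub>C T) \<le> cmod c * norm T" for c and T :: "'a bop"
  proof (rule norm_bop_le)
    fix x
    show "norm (bop_apply (c *\<^sub>C T) x) \<le> cmod c * norm T * norm x"
      using mult_left_mono[OF norm_bop_apply[of T x], of "cmod c"]
      by (simp add: bop_apply_simps norm_scaleC mult.assoc)
  qed simp
  show ?thesis
  proof (cases "c = 0")
    case False
    then show ?thesis by (intro scaleC_homogeneousI le)
  qed (simp add: scaleC_zero_left)
qed

instance calkin :: (complex_hilbert_space) neumann_algebra
proof
  fix x :: "'a calkin" and r :: real and c :: complex
  show "r *\<^sub>R x = complex_of_real r *\<^sub>C x" by (rule scaleR_calkin_def)
  have le: "norm (c *\<^sub>C x) \<le> cmod c * norm x" if "c \<noteq> 0" for c and x :: "'a calkin"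
  proof -
    have "norm (c *\<^sub>C x) / cmod c \<le> norm x"
    proof (rule norm_calkin_greatest)
      fix T assume "calkin_proj T = x"
      then show "norm (c *\<^sub>C x) / cmod c \<le> norm T"
        using norm_calkin_proj_le[of "c *\<^sub>C T"] that
        by (simp add: calkin_proj_arith norm_scaleC_bop pos_divide_le_eq mult.commute)
    qed
    then show ?thesis using that by (simp add: pos_divide_le_eq mult.commute)
  qed
  show "norm (c *\<^sub>C x) = cmod c * norm x"
  proof (cases "c = 0")
    case False
    then show ?thesis by (intro scaleC_homogeneousI le)
  qed (simp add: scaleC_zero_left)
  show "\<exists>y. y * (1 - x) = 1 \<and> (1 - x) * y = 1" if less: "norm x < 1"
  proof -
    obtain C where C: "calkin_proj C = x" "norm C < 1"
      using norm_calkin_approx[of "1 - norm x" x] less by auto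
    obtain y where "y * (1 - C) = 1" "(1 - C) * y = 1" using bop_neumann[OF C(2)] by blast
    then have "calkin_proj (y * (1 - C)) = 1" "calkin_proj ((1 - C) * y) = 1"
      by (simp_all add: calkin_proj_arith)
    then show ?thesis using C(1) by (auto simp: calkin_proj_arith)
  qed
qed

section \<open>Density\<close>

text \<open>For \<open>m\<close> outside the spectrum of \<open>a\<close>, the relation \<open>(a - m) x = (l - m) x\<close>
  gives \<open>a + x - m = (a - m) (1 + x / (l - m))\<close>, a product of invertible elements.\<close>
lemma spectrum_nilpotent_perturbation:
  fixes a x :: "'a::neumann_algebra"
  assumes "l \<in> spectrum a" "a * x = l *\<^sub>C x" "x ^ k = 0"
  shows "spectrum (a + x) \<subseteq> spectrum a"
proof
  fix m assume m: "m \<in> spectrum (a + x)"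
  show "m \<in> spectrum a"
  proof (rule ccontr)
    assume not: "m \<notin> spectrum a"
    then have ml: "m - l \<noteq> 0" using assms(1) by auto
    define y where "y = inverse (m - l) *\<^sub>C x"
    have "y ^ k = 0" by (simp add: y_def power_scaleC assms(3) scaleC_zero_right)
    then have "has_inverse (1 - y)" by (rule has_inverse_one_minus_nilpotent)
    moreover have "has_inverse (a - m *\<^sub>C 1)" using not by (simp add: in_spectrum_iff)
    ultimately have "has_inverse ((a - m *\<^sub>C 1) * (1 - y))" by (intro has_inverse_mult)
    also have "(a - m *\<^sub>C 1) * y = inverse (m - l) *\<^sub>C ((l - m) *\<^sub>C x)"
      by (simp add: y_def left_diff_distrib mult_scaleC_left mult_scaleC_right assms(2) scaleC_diff_left)
    then have "(a - m *\<^sub>C 1) * y = - x"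
    proof -
      have "inverse (m - l) * (l - m) = - 1" using ml by (simp add: field_simps)
      then show ?thesis
        using \<open>(a - m *\<^sub>C 1) * y = _\<close> by (simp add: scaleC_scaleC scaleC_minus_left scaleC_one)
    qed
    then have "(a - m *\<^sub>C 1) * (1 - y) = a + x - m *\<^sub>C 1"
      by (simp add: right_diff_distrib)
    finally show False using m by (simp add: in_spectrum_iff)
  qed
qed

lemma approximate_eigenvectors:
  fixes T :: "'h::complex_hilbert_space bop"
  assumes "l \<in> spectrum (calkin_proj T)" "l \<in> closure (- spectrum (calkin_proj T))"
  obtains e where "orthonormal e (UNIV :: nat set)"
    "\<And>n. norm (bop_apply (T - l *\<^sub>C 1) (e n)) \<le> (1/2) ^ n"
proof (rule orthonormal_sequence_exists[of "\<lambda>n x. norm (bop_apply (T - l *\<^sub>C 1) x) \<le> (1/2) ^ n"])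
  fix n and e :: "nat \<Rightarrow> 'h" assume e: "orthonormal e {..<n}"
  have "\<exists>x. norm x = 1 \<and> (\<forall>i\<in>{..<n}. cinner x (e i) = 0)
      \<and> norm (bop_apply (T - l *\<^sub>C 1) x) \<le> (1/2) ^ n"
  proof (rule calkin_zero_divisor_orthogonal[OF _ _ e])
    fix \<eta> :: real assume "\<eta> > 0"
    then show "\<exists>u. norm (calkin_proj (T - l *\<^sub>C 1) * u) < \<eta> * norm u"
      using spectrum_boundary_zero_divisor[OF assms] by (simp add: calkin_proj_arith)
  qed auto
  then show "\<exists>x. norm x = 1 \<and> (\<forall>i<n. cinner x (e i) = 0)
      \<and> norm (bop_apply (T - l *\<^sub>C 1) x) \<le> (1/2) ^ n" by auto
qed (rule that)

lemma bop_apply_poly_eval: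
  "bop_apply (poly_eval p T) x = (\<Sum>i\<le>degree p. coeff p i *\<^sub>C bop_apply (T ^ i) x)"
  by (simp add: poly_eval_def bop_apply_sum bop_apply_simps)

text \<open>Let \<open>v\<close> be the last vector of the \<open>k\<close>-th block. Up to errors that vanish
  as \<open>k\<close> grows, the powers of \<open>S + c N\<close> walk down the block, sending \<open>v\<close> to multiples \<open>c\<^sup>j\<close> of the
  successive basis vectors. So \<open>p(S + c N) v\<close> is close to an orthogonal sum whose norm does not depend
  on \<open>k\<close>, and the block ends form an orthonormal sequence.\<close>
lemma calkin_norm_poly_jordan_chains:
  fixes S :: "'h::complex_hilbert_space bop" and N :: "'h bop"
    and p :: "complex poly" and c :: complex
  defines "m \<equiv> degree p"
  assumes e: "orthonormal e (UNIV :: nat set)"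
    and S: "(\<lambda>n. bop_apply S (e n)) \<longlonglongrightarrow> 0"
    and N: "\<And>k j. j < m \<Longrightarrow> bop_apply N (e (Suc m * k + Suc j)) = e (Suc m * k + j)"
  shows "(\<Sum>j\<le>m. (cmod (coeff p j * c ^ j))\<^sup>2) \<le> (norm (poly_eval p (calkin_proj (S + c *\<^sub>C N))))\<^sup>2"
proof -
  let ?T = "S + c *\<^sub>C N"
  let ?v = "\<lambda>k. e (Suc m * k + m)"
  have power_lim: "(\<lambda>k. bop_apply (?T ^ j) (?v k) - c ^ j *\<^sub>C e (Suc m * k + (m - j))) \<longlonglongrightarrow> 0"
    if "j \<le> m" for j
    using that
  proof (induction j)
    case 0
    then show ?case by (simp add: bop_apply_simps scaleC_one)
  next
    case (Suc j)
    let ?w = "\<lambda>k. e (Suc m * k + (m - j))"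
    have mj: "m - j = Suc (m - Suc j)" "m - Suc j < m" using Suc.prems by auto
    have "bop_apply (?T ^ Suc j) (?v k) - c ^ Suc j *\<^sub>C e (Suc m * k + (m - Suc j))
        = bop_apply ?T (bop_apply (?T ^ j) (?v k) - c ^ j *\<^sub>C ?w k)
          + c ^ j *\<^sub>C bop_apply S (?w k)" for k
    proof -
      have "bop_apply N (?w k) = e (Suc m * k + (m - Suc j))"
        using N[OF mj(2), of k] mj(1) by simp
      then have "bop_apply ?T (c ^ j *\<^sub>C ?w k)
          = c ^ j *\<^sub>C bop_apply S (?w k) + c ^ Suc j *\<^sub>C e (Suc m * k + (m - Suc j))"
        by (simp add: bop_apply_scaleC bop_apply_simps scaleC_add_right scaleC_scaleC mult.commute)
      then show ?thesis by (simp add: bop_apply_linear bop_apply_simps(6))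
    qed
    moreover have "(\<lambda>k. bop_apply ?T (bop_apply (?T ^ j) (?v k) - c ^ j *\<^sub>C ?w k)) \<longlonglongrightarrow> bop_apply ?T 0"
      using Suc by (intro bounded_linear.tendsto[OF bounded_linear_bop_apply]) auto
    moreover have "(\<lambda>k. c ^ j *\<^sub>C bop_apply S (?w k)) \<longlonglongrightarrow> c ^ j *\<^sub>C 0"
    proof (rule bounded_linear.tendsto[OF bounded_linear_scaleC])
      have "strict_mono (\<lambda>k. Suc m * k + (m - j))"
        unfolding strict_mono_def by (intro allI impI add_strict_right_mono mult_strict_left_mono) auto
      from LIMSEQ_subseq_LIMSEQ[OF S this] show "(\<lambda>k. bop_apply S (?w k)) \<longlonglongrightarrow> 0"
        by (simp add: o_def)
    qed
    ultimately show ?case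
      using tendsto_add by (fastforce simp: bop_apply_linear scaleC_zero_right)
  qed
  define t where "t k = (\<Sum>j\<le>m. (coeff p j * c ^ j) *\<^sub>C e (Suc m * k + (m - j)))" for k
  define b where "b = sqrt (\<Sum>j\<le>m. (cmod (coeff p j * c ^ j))\<^sup>2)"
  have t: "norm (t k) = b" for k
  proof -
    have "orthonormal (\<lambda>j. e (Suc m * k + (m - j))) {..m}"
      by (rule orthonormal_compose[OF e]) (auto simp: inj_on_def)
    then have "(norm (t k))\<^sup>2 = (\<Sum>j\<le>m. (cmod (coeff p j * c ^ j))\<^sup>2)"
      unfolding t_def by (intro norm_orthonormal_sum) auto
    then show ?thesis by (simp add: b_def real_sqrt_unique)
  qed
  have "(\<lambda>k. \<Sum>j\<le>m. coeff p j *\<^sub>C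
        (bop_apply (?T ^ j) (?v k) - c ^ j *\<^sub>C e (Suc m * k + (m - j)))) \<longlonglongrightarrow> (\<Sum>j\<le>m. coeff p j *\<^sub>C 0)"
    by (intro tendsto_sum bounded_linear.tendsto[OF bounded_linear_scaleC] power_lim) auto
  also have "(\<lambda>k. \<Sum>j\<le>m. coeff p j *\<^sub>C
        (bop_apply (?T ^ j) (?v k) - c ^ j *\<^sub>C e (Suc m * k + (m - j))))
      = (\<lambda>k. bop_apply (poly_eval p ?T) (?v k) - t k)"
    by (simp add: bop_apply_poly_eval t_def m_def scaleC_diff_right scaleC_scaleC sum_subtractf)
  finally have "(\<lambda>k. norm (bop_apply (poly_eval p ?T) (?v k) - t k)) \<longlonglongrightarrow> 0"
    by (simp add: scaleC_zero_right tendsto_norm_zero)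
  then have "(\<lambda>k. norm (bop_apply (poly_eval p ?T) (?v k)) - b) \<longlonglongrightarrow> 0"
  proof (rule Lim_null_comparison[rotated], intro always_eventually allI)
    fix k
    show "norm (norm (bop_apply (poly_eval p ?T) (?v k)) - b) \<le> norm (bop_apply (poly_eval p ?T) (?v k) - t k)"
      using norm_triangle_ineq3[of "bop_apply (poly_eval p ?T) (?v k)" "t k"] by (simp only: t real_norm_def)
  qed
  then have "(\<lambda>k. norm (bop_apply (poly_eval p ?T) (?v k))) \<longlonglongrightarrow> b"
    by (simp add: LIM_zero_iff)
  moreover have "orthonormal ?v UNIV"
    by (rule orthonormal_compose[OF e]) (auto simp: inj_on_def simp del: mult_Suc)
  ultimately have "b \<le> norm (poly_eval p (calkin_proj ?T))"
    unfolding calkin_proj_poly_eval[symmetric] by (intro calkin_norm_ge_orthonormal_limit)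
  then have "b\<^sup>2 \<le> (norm (poly_eval p (calkin_proj ?T)))\<^sup>2"
    by (intro power_mono) (auto simp: b_def sum_nonneg)
  then show ?thesis by (simp add: b_def sum_nonneg)
qed

lemma spectral_radius_less_norm_dense:
  fixes T :: "'h::complex_hilbert_space bop"
  assumes "\<not> finite_dimensional TYPE('h)" "degree p > 0" "\<epsilon> > 0"
  shows "\<exists>S. norm (S - T) < \<epsilon> \<and>
    spectral_radius (poly_eval p (calkin_proj S)) < norm (poly_eval p (calkin_proj S))"
proof -
  note one = calkin_one_neq_zero[OF assms(1)]
  let ?a = "calkin_proj T"
  have "continuous_on (spectrum ?a) (\<lambda>z. cmod (poly p z))" by (intro continuous_intros)
  then obtain l where l: "l \<in> spectrum ?a" and max: "\<And>z. z \<in> spectrum ?a \<Longrightarrow> cmod (poly p z) \<le> cmod (poly p l)"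
    using continuous_attains_sup[OF compact_spectrum spectrum_nonempty[OF one],
        of ?a "\<lambda>z. cmod (poly p z)"] by blast
  have "l \<in> closure (- spectrum ?a)"
    using poly_max_in_closure_compl[OF assms(2) l max] .
  then obtain e where e: "orthonormal e (UNIV :: nat set)"
    and small: "\<And>n. norm (bop_apply (T - l *\<^sub>C 1) (e n)) \<le> (1/2) ^ n"
    using approximate_eigenvectors[OF l] by blast
  define m where "m = degree p"
  \<comment> \<open>Block \<open>k\<close> consists of the indices from \<open>Suc m * k\<close> to \<open>Suc m * k + m\<close>; the link from its end to the next block is cut.\<close>
  define d where "d n \<longleftrightarrow> \<not> Suc m dvd Suc n" for n
  define N where "N = shift_op e d"
  define c where "c = complex_of_real (\<epsilon> / 2)"
  define S where "S = T + c *\<^sub>C N"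
  have c: "cmod c = \<epsilon> / 2" using assms(3) by (simp add: c_def)

  have "norm (S - T) \<le> \<epsilon> / 2 * 1"
    using norm_shift_op[OF e, of d] assms(3)
    unfolding S_def N_def by (simp add: norm_scaleC_bop c)
  then have dist: "norm (S - T) < \<epsilon>" using assms(3) by simp

  have "\<exists>i\<le>m. \<not> d (n + i)" for n
  proof -
    have "Suc m dvd Suc (n + (m - n mod Suc m))"
    proof -
      have "n mod Suc m \<le> m" by (simp add: less_Suc_eq_le[symmetric])
      then have "Suc (n + (m - n mod Suc m)) = (n div Suc m) * Suc m + Suc m"
        using div_mult_mod_eq[of n "Suc m"] by linarith
      then show ?thesis by (metis dvd_add dvd_refl dvd_triv_right)
    qed
    then show ?thesis unfolding d_def by (intro exI[of _ "m - n mod Suc m"]) auto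
  qed
  then have nilpotent: "N ^ Suc m = 0" unfolding N_def by (intro shift_op_nilpotent e)
  have "compact_op ((T - l *\<^sub>C 1) * N)"
    unfolding N_def by (intro compact_op_mult_shift_op e small)
  then have eigen: "?a * calkin_proj N = l *\<^sub>C calkin_proj N"
    using calkin_proj_eq_iff[of "T * N" "l *\<^sub>C N"]
    by (simp add: calkin_proj_arith left_diff_distrib mult_scaleC_left)
  have "spectrum (?a + c *\<^sub>C calkin_proj N) \<subseteq> spectrum ?a"
  proof (rule spectrum_nilpotent_perturbation[OF l])
    show "?a * (c *\<^sub>C calkin_proj N) = l *\<^sub>C (c *\<^sub>C calkin_proj N)"
      by (simp add: mult_scaleC_right eigen scaleC_scaleC mult.commute)
    have "calkin_proj N ^ Suc m = 0"
      using nilpotent by (metis calkin_proj_power calkin_proj_arith(1))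
    then show "(c *\<^sub>C calkin_proj N) ^ Suc m = 0"
      by (simp only: power_scaleC scaleC_zero_right)
  qed
  then have sub: "spectrum (calkin_proj S) \<subseteq> spectrum ?a"
    by (simp add: S_def calkin_proj_arith)
  have radius: "spectral_radius (poly_eval p (calkin_proj S)) \<le> cmod (poly p l)"
  proof (rule spectral_radius_le[OF one])
    fix z assume "z \<in> spectrum (poly_eval p (calkin_proj S))"
    then obtain w where "w \<in> spectrum (calkin_proj S)" "z = poly p w"
      using spectrum_poly_eval_subset[OF assms(2)] by blast
    then show "cmod z \<le> cmod (poly p l)" using sub max by auto
  qed

  \<comment> \<open>The coefficients of \<open>r\<close> are the Taylor coefficients of \<open>p\<close> at \<open>l\<close>.\<close>
  define r where "r = p \<circ>\<^sub>p [:l, 1:]"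
  have deg: "degree r = m" by (simp add: r_def m_def degree_pcompose)
  have "(\<lambda>n. (1/2::real) ^ n) \<longlonglongrightarrow> 0" by (rule LIMSEQ_realpow_zero) auto
  then have lim: "(\<lambda>n. bop_apply (T - l *\<^sub>C 1) (e n)) \<longlonglongrightarrow> 0"
    by (rule Lim_null_comparison[rotated]) (simp add: small)
  have basis: "bop_apply N (e (Suc m * k + Suc j)) = e (Suc m * k + j)" if "j < m" for k j
  proof -
    have "\<not> Suc m dvd Suc m * k + Suc j"
    proof
      assume "Suc m dvd Suc m * k + Suc j"
      then have "Suc m dvd Suc j" by (simp only: dvd_add_right_iff dvd_triv_left)
      then show False using that by (auto dest!: dvd_imp_le)
    qed
    then have "d (Suc m * k + j)" by (simp add: d_def)
    then show ?thesis using shift_op_basis[OF e] by (simp add: N_def)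
  qed
  have "(\<Sum>j\<le>m. (cmod (coeff r j * c ^ j))\<^sup>2)
      \<le> (norm (poly_eval r (calkin_proj ((T - l *\<^sub>C 1) + c *\<^sub>C N))))\<^sup>2"
    using calkin_norm_poly_jordan_chains[OF e lim, of r N c] basis by (simp add: deg)
  also have "calkin_proj ((T - l *\<^sub>C 1) + c *\<^sub>C N) = calkin_proj S - l *\<^sub>C 1"
    by (simp add: S_def calkin_proj_arith algebra_simps)
  also have "poly_eval r (calkin_proj S - l *\<^sub>C 1) = poly_eval p (calkin_proj S)"
    unfolding r_def by (rule poly_eval_translate)
  finally have norm_ge: "(\<Sum>j\<le>m. (cmod (coeff r j * c ^ j))\<^sup>2) \<le> (norm (poly_eval p (calkin_proj S)))\<^sup>2" .
  have m: "m > 0" using assms(2) by (simp add: m_def)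
  have r0: "coeff r 0 = poly p l" by (simp add: r_def poly_0_coeff_0[symmetric] poly_pcompose)
  have "coeff r m \<noteq> 0" using deg m by auto
  then have "0 < (cmod (coeff r m * c ^ m))\<^sup>2" using assms(3) by (simp add: c_def)
  then have "(cmod (poly p l))\<^sup>2 < (\<Sum>j\<in>{0, m}. (cmod (coeff r j * c ^ j))\<^sup>2)"
    using m by (simp add: r0)
  also have "\<dots> \<le> (\<Sum>j\<le>m. (cmod (coeff r j * c ^ j))\<^sup>2)" by (intro sum_mono2) auto
  finally have "(cmod (poly p l))\<^sup>2 < (norm (poly_eval p (calkin_proj S)))\<^sup>2" using norm_ge by linarith
  then have "cmod (poly p l) < norm (poly_eval p (calkin_proj S))"
    by (rule power2_less_imp_less) simp
  with radius dist show ?thesis by (intro exI[of _ S]) linarith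
qed

section \<open>Finite intersections of open dense sets\<close>

lemma closure_Inter_open_dense:
  assumes "finite I" "\<And>i. i \<in> I \<Longrightarrow> open (A i)" "\<And>i. i \<in> I \<Longrightarrow> closure (A i) = UNIV"
  shows "closure (\<Inter>i\<in>I. A i) = UNIV"
  using assms
proof (induction I)
  case (insert i I)
  have "closure (A i \<inter> (\<Inter>j\<in>I. A j)) = closure (A i)"
    by (rule closure_open_Int_superset) (use insert in auto)
  then show ?case using insert.prems by simp
qed simp

theorem theorem10:
  fixes p :: "nat \<Rightarrow> complex poly" and n :: nat
  assumes "\<not> finite_dimensional TYPE('h::complex_hilbert_space)"
    and "\<And>i. i \<in> {1..n} \<Longrightarrow> degree (p i) > 0"
  shows "nowhere_dense (- calkin_Sigma n p :: 'h bop set)"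
proof -
  define A :: "nat \<Rightarrow> 'h bop set" where "A i = {T. spectral_radius (poly_eval (p i) (calkin_proj T))
    < norm (poly_eval (p i) (calkin_proj T))}" for i
  have Sigma: "calkin_Sigma n p = (\<Inter>i\<in>{1..n}. A i)"
    by (auto simp: calkin_Sigma_def calkin_G_def A_def)
  have open_A: "open (A i)" for i
  proof -
    have "open ((\<lambda>T :: 'h bop. poly_eval (p i) (calkin_proj T)) -` {b. spectral_radius b < norm b})"
      by (intro open_vimage open_spectral_radius_less_norm calkin_one_neq_zero[OF assms(1)]
          continuous_on_poly_eval continuous_on_calkin_proj)
    then show ?thesis by (simp add: A_def vimage_def)
  qed
  have dense_A: "closure (A i) = UNIV" if "i \<in> {1..n}" for i
  proof -
    have "T \<in> closure (A i)" for T
      using spectral_radius_less_norm_dense[OF assms(1) assms(2)[OF that], of _ T]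
      by (auto simp: closure_approachable A_def dist_norm)
    then show ?thesis by blast
  qed
  have "open (calkin_Sigma n p :: 'h bop set)"
    unfolding Sigma using open_A by (intro open_INT) auto
  moreover have "closure (calkin_Sigma n p :: 'h bop set) = UNIV"
    unfolding Sigma using open_A dense_A by (intro closure_Inter_open_dense) auto
  ultimately show ?thesis
    by (simp add: nowhere_dense_def closure_closed closed_def interior_complement)
qed

end
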